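(* Let $\{W_k\}_{k=1}^d$ be i.i.d. standard Wiener processes and, for every multi-index $\alpha=(\alpha_1,\dots,\alpha_\ell)$, define $W_\alpha=W_{\alpha_1}\cdots W_{\alpha_\ell}$, with $W_\emptyset=1$. Let $m\ge0$. Then there exists a universal family of negligible events $\mathrm{Osc}^m_W=\{\mathrm{Osc}^{m,\varepsilon}_W\}_{\varepsilon\le1}$, depending only on $m$ (and on the Wiener processes), such that the following holds for every family $(A_\alpha)$ of (not necessarily adapted) stochastic processes on $[0,1]$ with $A_\alpha=0$ whenever $|\alpha|>m$. Setting $Z_A(t)=\sum_\alpha A_\alpha(t)W_\alpha(t)$, the implication $$\|Z_A\|_{L^\infty}\le\varepsilon\quad\Longrightarrow\quad\Big\{\text{either }\ \sup_\alpha\|A_\alpha\|_{L^\infty}\le\varepsilon^{3^{-m}}\quad\text{or}\quad\sup_\alpha\|A_\alpha\|_{\mathrm{Lip}}\ge\varepsilon^{-3^{-(m+1)}}\Big\}$$ holds modulo $\mathrm{Osc}^m_W$, i.e. for every $\varepsilon\in(0,1]$ it holds on the complement of $\mathrm{Osc}^{m,\varepsilon}_W$.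
   Context: Multi-indices are unordered finite collections (multisets), possibly empty, of elements of $\{1,\dots,d\}$; $|\alpha|$ is the number of elements counted with multiplicity, and exactly one process $A_\alpha$ is attached to each multiset. All supremum norms $\|\cdot\|_{L^\infty}$ are over the time interval $[0,1]$, and $\|A\|_{\mathrm{Lip}}$ is the Lipschitz norm on $[0,1]$, i.e. $\|A\|_{L^\infty}$ plus the best Lipschitz constant of $A$ ($+\infty$ if $A$ is not Lipschitz). A family $\{H^\varepsilon\}_{\varepsilon\le1}$ of events (indexed by $\varepsilon\in(0,1]$) is negligible if for every $p\ge1$ there is a constant $C_p$ with $\mathbf P(H^\varepsilon)\le C_p\varepsilon^p$ for every $\varepsilon\le1$. "Universal" means that the family does not depend on the processes $A_\alpha$. *)

theory Defs
  imports "HOL-Probability.Probability"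
begin

definition multi_indices :: "nat \<Rightarrow> nat multiset set" where
  "multi_indices d = {\<alpha>. set_mset \<alpha> \<subseteq> {1..d}}"

text \<open>Pointwise supremum (not essential supremum); it takes the value \<open>\<infinity>\<close> on unbounded functions.\<close>

definition sup_norm :: "(real \<Rightarrow> real) \<Rightarrow> ennreal" where
  "sup_norm f = (SUP t\<in>{0..1}. ennreal \<bar>f t\<bar>)"

text \<open>If \<open>f\<close> is not Lipschitz on the unit interval, the infimum ranges over the empty set
  and the value is \<open>\<infinity>\<close>.\<close>

definition lip_norm :: "(real \<Rightarrow> real) \<Rightarrow> ennreal" where
  "lip_norm f = sup_norm f + (INF L\<in>{L. L-lipschitz_on {0..1} f}. ennreal L)"

context prob_space
begin

text \<open>Only the time interval \<open>[0, 1]\<close> matters, so the process is constrained there only; the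
  restriction to \<open>[0, 1]\<close> of a Wiener process on the half-line is an instance. The initial
  value and the continuity of paths are required almost surely.\<close>

definition standard_wiener :: "(real \<Rightarrow> 'a \<Rightarrow> real) \<Rightarrow> bool" where
  "standard_wiener W \<longleftrightarrow>
     (\<forall>t\<in>{0..1}. random_variable borel (W t)) \<and>
     (AE \<omega> in M. W 0 \<omega> = 0) \<and>
     (AE \<omega> in M. continuous_on {0..1} (\<lambda>t. W t \<omega>)) \<and>
     (\<forall>s t. 0 \<le> s \<and> s < t \<and> t \<le> 1 \<longrightarrow>
        distributed M lborel (\<lambda>\<omega>. W t \<omega> - W s \<omega>) (\<lambda>x. ennreal (normal_density 0 (sqrt (t - s)) x))) \<and>
     (\<forall>(n::nat) t. (\<forall>i\<le>n. t i \<in> {0..1}) \<and> (\<forall>i<n. t i < t (Suc i)) \<longrightarrow>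
        indep_vars (\<lambda>_. borel) (\<lambda>i \<omega>. W (t (Suc i)) \<omega> - W (t i) \<omega>) {..<n})"

text \<open>Independence is that of the whole processes, viewed as random elements of the product
  space of real functions on \<open>[0, 1]\<close>. Equality in law is implied by each process being
  a standard Wiener process.\<close>

definition iid_standard_wiener :: "nat \<Rightarrow> (nat \<Rightarrow> real \<Rightarrow> 'a \<Rightarrow> real) \<Rightarrow> bool" where
  "iid_standard_wiener d W \<longleftrightarrow>
     (\<forall>k\<in>{1..d}. standard_wiener (W k)) \<and>
     indep_vars (\<lambda>_. PiM {0..1} (\<lambda>_. borel)) (\<lambda>k \<omega>. \<lambda>t\<in>{0..1}. W k t \<omega>) {1..d}"

definition negligible_events :: "(real \<Rightarrow> 'a set) \<Rightarrow> bool" where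
  "negligible_events H \<longleftrightarrow>
     (\<forall>\<epsilon>\<in>{0<..1}. H \<epsilon> \<in> events) \<and>
     (\<forall>p::real. p \<ge> 1 \<longrightarrow> (\<exists>C::real. \<forall>\<epsilon>\<in>{0<..1}. prob (H \<epsilon>) \<le> C * \<epsilon> powr p))"

end

definition wiener_monomial ::
    "(nat \<Rightarrow> real \<Rightarrow> 'a \<Rightarrow> real) \<Rightarrow> nat multiset \<Rightarrow> real \<Rightarrow> 'a \<Rightarrow> real" where
  "wiener_monomial W \<alpha> t \<omega> = (\<Prod>k\<in>#\<alpha>. W k t \<omega>)"

text \<open>The sum runs over all multi-indices; it is used only for families with
  \<open>A \<alpha> = 0\<close> for all but finitely many \<open>\<alpha>\<close>.\<close>

definition wiener_polynomial ::
    "nat \<Rightarrow> (nat \<Rightarrow> real \<Rightarrow> 'a \<Rightarrow> real) \<Rightarrow> (nat multiset \<Rightarrow> real \<Rightarrow> 'a \<Rightarrow> real) \<Rightarrow> real \<Rightarrow> 'a \<Rightarrow> real" where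
  "wiener_polynomial d W A t \<omega> = (\<Sum>\<^sub>\<infinity>\<alpha>\<in>multi_indices d. A \<alpha> t \<omega> * wiener_monomial W \<alpha> t \<omega>)"

end

theory Submission
  imports Defs
begin

text \<open>During a time window so short that the coefficients hardly move, a Wiener polynomial
  is a polynomial with frozen coefficients evaluated along the path, and up to second order its
  increments are scalar products of the gradient at the start of the window with increments of the
  path. If the polynomial is bounded by \<open>\<rho>\<close>, so are these scalar products, up to
  constants and errors. Scalar products alone say nothing about single components, because of
  cancellations; but among many consecutive increments of \<open>d\<close> independent Wiener
  processes every one of the \<open>2 ^ d\<close> sign patterns occurs with all components of at
  least typical size \<open>sqrt \<delta>\<close>, where \<open>\<delta>\<close> is the length of
  a step. The pattern that agrees with the signs of the gradient excludes any cancellation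
  (\<open>gradient_bound_by_increments\<close>). So the gradient is at most of order \<open>\<rho>
  / sqrt \<delta>\<close>, as long as the error \<open>\<Lambda> * \<delta>\<close> of freezing
  the coefficients and of the second order terms stays below \<open>\<rho>\<close>; here
  \<open>\<Lambda>\<close> bounds the coefficients and their Lipschitz constants. The best choice
  \<open>\<delta> = \<rho> / \<Lambda>\<close> gives the bound \<open>sqrt (\<rho> *
  \<Lambda>)\<close>.

  The components of the gradient are Wiener polynomials of degree one less, so this can be
  iterated (\<open>small_coefficients\<close>). If \<open>\<Lambda>\<close> is at most
  \<open>\<epsilon>\<close> to the power \<open>- (1 / 3 ^ (m + 1))\<close> and
  \<open>\<rho>\<close> is \<open>\<epsilon>\<close> to the power \<open>1 / 3 ^ j\<close> with
  \<open>j < m\<close>, then \<open>sqrt (\<rho> * \<Lambda>)\<close> has at least the exponent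
  \<open>4 / 9 / 3 ^ j\<close>, which is larger than \<open>1 / 3 ^ (j + 1)\<close>. The room
  between \<open>4 / 9\<close> and \<open>1 / 3\<close> absorbs all constants and all small powers
  of \<open>1 / \<epsilon>\<close>. Once the coefficients of the nonempty multi-indices are small,
  subtracting their terms shows that the remaining coefficient is small too. All this happens at
  the points of a finite grid; in between, the Lipschitz bound takes over.

  The properties of the path that enter (\<open>regular_path\<close>) concern finitely many
  increments and do not involve the coefficients, which is why the exceptional events are
  universal. For a grid of polynomial size in \<open>q\<close> a path is irregular with
  probability smaller than every power of \<open>1 / q\<close>
  (\<open>irregular_event_superpolynomial\<close>): an increment exceeds \<open>q\<close> standard
  deviations with a probability controlled by the moments of the normal law, and \<open>q -
  1\<close> independent increments all miss a given sign pattern with a probability that is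
  geometric in \<open>q\<close>.

  The scale \<open>\<epsilon>\<close> enters only through an integer \<open>q\<close> close to
  \<open>\<epsilon>\<close> to the power \<open>- (1 / Q)\<close> with a large exponent
  \<open>Q\<close>. All bounds and mesh sizes are powers of \<open>q\<close>, so the grids are
  nested and the comparison of exponents is arithmetic of natural numbers. Large
  \<open>\<epsilon>\<close> need no argument, as the exceptional event may then be the whole
  space.\<close>

section \<open>Polynomials with coefficients indexed by multi-indices\<close>

definition multi_indices_upto :: "nat \<Rightarrow> nat \<Rightarrow> nat multiset set" where
  "multi_indices_upto d n = {\<alpha> \<in> multi_indices d. size \<alpha> \<le> n}"

definition monomial_at :: "(nat \<Rightarrow> real) \<Rightarrow> nat multiset \<Rightarrow> real" where
  "monomial_at x \<alpha> = (\<Prod>k\<in>#\<alpha>. x k)"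

definition poly_at :: "nat \<Rightarrow> nat \<Rightarrow> (nat multiset \<Rightarrow> real) \<Rightarrow> (nat \<Rightarrow> real) \<Rightarrow> real" where
  "poly_at d n a x = (\<Sum>\<alpha>\<in>multi_indices_upto d n. a \<alpha> * monomial_at x \<alpha>)"

text \<open>These are the coefficients of the partial derivative in direction \<open>k\<close>:
  the monomial of \<open>add_mset k \<beta>\<close> contains the variable \<open>k\<close> exactly
  \<open>Suc (count \<beta> k)\<close> times.\<close>

definition deriv_coeffs :: "nat \<Rightarrow> (nat multiset \<Rightarrow> real) \<Rightarrow> nat multiset \<Rightarrow> real" where
  "deriv_coeffs k a \<beta> = real (Suc (count \<beta> k)) * a (add_mset k \<beta>)"

text \<open>The differential at \<open>x\<close> in direction \<open>h\<close>, by the product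
  rule over the elements of \<open>\<alpha>\<close>.\<close>

definition monomial_diff :: "(nat \<Rightarrow> real) \<Rightarrow> (nat \<Rightarrow> real) \<Rightarrow> nat multiset \<Rightarrow> real" where
  "monomial_diff x h \<alpha> = (\<Sum>k\<in>#\<alpha>. monomial_at x (\<alpha> - {#k#}) * h k)"

lemma finite_multi_indices_upto [simp]: "finite (multi_indices_upto d n)"
proof -
  have "multi_indices_upto d n \<subseteq> (\<Union>i\<in>{..n}. multisets_of_size {1..d} i)"
    by (auto simp: multi_indices_upto_def multi_indices_def multisets_of_size_def)
  then show ?thesis
    by (rule finite_subset) auto
qed

lemma empty_in_multi_indices_upto [simp]: "{#} \<in> multi_indices_upto d n"
  by (simp add: multi_indices_upto_def multi_indices_def)

lemma multi_indices_upto_0: "multi_indices_upto d 0 = {{#}}"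
  by (auto simp: multi_indices_upto_def multi_indices_def)

lemma monomial_at_empty [simp]: "monomial_at x {#} = 1"
  and monomial_at_add [simp]: "monomial_at x (add_mset k \<alpha>) = x k * monomial_at x \<alpha>"
  by (simp_all add: monomial_at_def)

lemma monomial_diff_empty [simp]: "monomial_diff x h {#} = 0"
  by (simp add: monomial_diff_def)

lemma monomial_diff_add [simp]:
  "monomial_diff x h (add_mset k \<alpha>) = x k * monomial_diff x h \<alpha> + monomial_at x \<alpha> * h k"
proof -
  have "image_mset (\<lambda>j. monomial_at x (add_mset k \<alpha> - {#j#}) * h j) \<alpha> =
        image_mset (\<lambda>j. x k * (monomial_at x (\<alpha> - {#j#}) * h j)) \<alpha>"
    by (rule image_mset_cong) (simp add: diff_union_swap2)
  then show ?thesis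
    by (simp add: monomial_diff_def sum_mset_distrib_left)
qed

lemma sum_mset_eq_sum_count:
  fixes f :: "'b \<Rightarrow> real"
  assumes "finite K" "set_mset \<alpha> \<subseteq> K"
  shows "(\<Sum>k\<in>#\<alpha>. f k) = (\<Sum>k\<in>K. real (count \<alpha> k) * f k)"
  using assms(2)
proof (induction \<alpha>)
  case (add j \<alpha>)
  have "(\<Sum>k\<in>K. real (count (add_mset j \<alpha>) k) * f k) =
        (\<Sum>k\<in>K. real (count \<alpha> k) * f k + (if k = j then f k else 0))"
    by (rule sum.cong) (auto simp: algebra_simps)
  then show ?case
    using add assms(1) by (simp add: sum.distrib)
qed simp

text \<open>The differential of a polynomial, regrouped by directions: removing one occurrence of
  \<open>k\<close> is a bijection from the multi-indices that contain \<open>k\<close> onto those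
  of size at most \<open>n\<close>. This is what makes the components of the gradient polynomials
  of the same kind, of degree one less.\<close>

lemma sum_monomial_diff:
  "(\<Sum>\<alpha>\<in>multi_indices_upto d (Suc n). a \<alpha> * monomial_diff x h \<alpha>) =
   (\<Sum>k\<in>{1..d}. poly_at d n (deriv_coeffs k a) x * h k)"
proof -
  let ?I = "multi_indices_upto d (Suc n)"
  let ?t = "\<lambda>k \<alpha>. a \<alpha> * (real (count \<alpha> k) * (monomial_at x (\<alpha> - {#k#}) * h k))"
  have shift: "(\<Sum>\<alpha>\<in>?I. ?t k \<alpha>) = poly_at d n (deriv_coeffs k a) x * h k" if k: "k \<in> {1..d}" for k
  proof -
    have im: "add_mset k ` multi_indices_upto d n = {\<alpha>\<in>?I. k \<in># \<alpha>}"
    proof (intro equalityI subsetI)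
      fix \<alpha> assume \<alpha>: "\<alpha> \<in> {\<alpha>\<in>?I. k \<in># \<alpha>}"
      then have "\<alpha> = add_mset k (\<alpha> - {#k#})" "\<alpha> - {#k#} \<in> multi_indices_upto d n"
        by (auto simp: multi_indices_upto_def multi_indices_def size_Diff_singleton dest: in_diffD)
      then show "\<alpha> \<in> add_mset k ` multi_indices_upto d n" by blast
    qed (use k in \<open>auto simp: multi_indices_upto_def multi_indices_def\<close>)
    have "(\<Sum>\<alpha>\<in>?I. ?t k \<alpha>) = (\<Sum>\<alpha>\<in>{\<alpha>\<in>?I. k \<in># \<alpha>}. ?t k \<alpha>)"
      by (rule sum.mono_neutral_right) (auto simp: not_in_iff)
    also have "\<dots> = (\<Sum>\<beta>\<in>multi_indices_upto d n. ?t k (add_mset k \<beta>))"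
      unfolding im[symmetric] by (subst sum.reindex) (auto simp: inj_on_def)
    finally show ?thesis
      by (simp add: poly_at_def deriv_coeffs_def sum_distrib_left sum_distrib_right mult_ac)
  qed
  have "(\<Sum>\<alpha>\<in>?I. a \<alpha> * monomial_diff x h \<alpha>) = (\<Sum>\<alpha>\<in>?I. \<Sum>k\<in>{1..d}. ?t k \<alpha>)"
  proof (rule sum.cong)
    fix \<alpha> assume "\<alpha> \<in> ?I"
    then have "set_mset \<alpha> \<subseteq> {1..d}" by (simp add: multi_indices_upto_def multi_indices_def)
    then show "a \<alpha> * monomial_diff x h \<alpha> = (\<Sum>k\<in>{1..d}. ?t k \<alpha>)"
      by (subst monomial_diff_def, subst sum_mset_eq_sum_count[of "{1..d}"]) (auto simp: sum_distrib_left)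
  qed simp
  also have "\<dots> = (\<Sum>k\<in>{1..d}. \<Sum>\<alpha>\<in>?I. ?t k \<alpha>)" by (rule sum.swap)
  finally show ?thesis using shift by simp
qed

lemma monomial_at_bound:
  assumes "1 \<le> R" "\<And>k. k \<in># \<alpha> \<Longrightarrow> \<bar>x k\<bar> \<le> R"
  shows "\<bar>monomial_at x \<alpha>\<bar> \<le> R ^ size \<alpha>"
  using assms(2)
proof (induction \<alpha>)
  case (add k \<alpha>)
  then show ?case
    using assms(1) by (auto simp: abs_mult intro!: mult_mono)
qed simp

text \<open>Both bounds follow from the product rule by induction on the multi-index; the second
  one uses the first for the term in which the new factor changes as well.\<close>

lemma monomial_taylor:
  assumes R: "1 \<le> R" and r: "0 \<le> r"
    and "\<And>k. k \<in># \<alpha> \<Longrightarrow> \<bar>x k\<bar> \<le> R" "\<And>k. k \<in># \<alpha> \<Longrightarrow> \<bar>y k\<bar> \<le> R"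
    and "\<And>k. k \<in># \<alpha> \<Longrightarrow> \<bar>y k - x k\<bar> \<le> r"
  shows "\<bar>monomial_diff x (\<lambda>k. y k - x k) \<alpha>\<bar> \<le> real (size \<alpha>) * R ^ size \<alpha> * r"
    and "\<bar>monomial_at y \<alpha> - monomial_at x \<alpha> - monomial_diff x (\<lambda>k. y k - x k) \<alpha>\<bar>
           \<le> (real (size \<alpha>))\<^sup>2 * R ^ size \<alpha> * r\<^sup>2"
  using assms(3-)
proof (induction \<alpha>)
  case (add k \<alpha>)
  {
    case 1
    let ?s = "real (size \<alpha>)" and ?P = "R ^ size \<alpha>"
    let ?D = "monomial_diff x (\<lambda>k. y k - x k) \<alpha>"
    have D: "\<bar>?D\<bar> \<le> ?s * ?P * r" using add 1 by auto
    have m: "\<bar>monomial_at x \<alpha>\<bar> \<le> ?P" using 1 R by (auto intro!: monomial_at_bound)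
    have xk: "\<bar>x k\<bar> \<le> R" and hk: "\<bar>y k - x k\<bar> \<le> r" using 1 by auto
    have "\<bar>x k * ?D + monomial_at x \<alpha> * (y k - x k)\<bar> \<le> \<bar>x k\<bar> * \<bar>?D\<bar> + \<bar>monomial_at x \<alpha>\<bar> * \<bar>y k - x k\<bar>"
      using abs_triangle_ineq[of "x k * ?D" "monomial_at x \<alpha> * (y k - x k)"] unfolding abs_mult .
    also have "\<dots> \<le> R * (?s * ?P * r) + ?P * r"
      using D m xk hk R by (intro add_mono mult_mono) auto
    also have "\<dots> \<le> R * (?s * ?P * r) + R * (?P * r)"
      using R r mult_right_mono[of 1 R "?P * r"] by simp
    finally show ?case by (simp add: algebra_simps)
  next
    case 2
    let ?s = "real (size \<alpha>)" and ?P = "R ^ size \<alpha>"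
    let ?D = "monomial_diff x (\<lambda>k. y k - x k) \<alpha>"
    let ?E = "monomial_at y \<alpha> - monomial_at x \<alpha> - ?D"
    have D: "\<bar>?D\<bar> \<le> ?s * ?P * r" and E: "\<bar>?E\<bar> \<le> ?s\<^sup>2 * ?P * r\<^sup>2" using add 2 by auto
    have yk: "\<bar>y k\<bar> \<le> R" and hk: "\<bar>y k - x k\<bar> \<le> r" using 2 by auto
    have "\<bar>y k * ?E + (y k - x k) * ?D\<bar> \<le> \<bar>y k\<bar> * \<bar>?E\<bar> + \<bar>y k - x k\<bar> * \<bar>?D\<bar>"
      using abs_triangle_ineq[of "y k * ?E" "(y k - x k) * ?D"] unfolding abs_mult .
    also have "\<dots> \<le> R * (?s\<^sup>2 * ?P * r\<^sup>2) + r * (?s * ?P * r)"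
      using D E yk hk R r by (intro add_mono mult_mono) auto
    also have "r * (?s * ?P * r) \<le> R * (?s * ?P * r\<^sup>2)"
      using R r mult_right_mono[of 1 R "?s * ?P * r\<^sup>2"] by (simp add: power2_eq_square algebra_simps)
    also have "R * (?s\<^sup>2 * ?P * r\<^sup>2) + R * (?s * ?P * r\<^sup>2) = (?s\<^sup>2 + ?s) * (R * ?P * r\<^sup>2)"
      by (simp add: algebra_simps)
    also have "\<dots> \<le> (?s + 1)\<^sup>2 * (R * ?P * r\<^sup>2)"
      using R r by (intro mult_right_mono) (auto simp: power2_eq_square algebra_simps)
    finally show ?case by (simp add: algebra_simps)
  }
qed simp_all

section \<open>The gradient is controlled by increments of all sign patterns\<close>

text \<open>By Taylor expansion at \<open>x 0\<close>, the scalar product of the gradient with any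
  single increment is the difference of two small values of the polynomial, up to second order
  errors. For an increment with the signs of the gradient this scalar product dominates every
  single component times \<open>\<eta>\<close>.\<close>

lemma gradient_bound_by_increments:
  assumes R: "1 \<le> R" and r: "0 \<le> r" and \<eta>: "0 \<le> \<eta>"
    and a: "\<And>\<alpha>. \<alpha> \<in> multi_indices_upto d (Suc n) \<Longrightarrow> \<bar>a \<alpha>\<bar> \<le> \<Lambda>"
    and xR: "\<And>i k. i \<le> N \<Longrightarrow> k \<in> {1..d} \<Longrightarrow> \<bar>x i k\<bar> \<le> R"
    and xr: "\<And>i k. i \<le> N \<Longrightarrow> k \<in> {1..d} \<Longrightarrow> \<bar>x i k - x 0 k\<bar> \<le> r"
    and small: "\<And>i. i \<le> N \<Longrightarrow> \<bar>poly_at d (Suc n) a (x i)\<bar> \<le> \<rho>"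
    and signs: "\<And>S. S \<subseteq> {1..d} \<Longrightarrow>
      \<exists>i<N. \<forall>k\<in>{1..d}. \<eta> \<le> (if k \<in> S then 1 else -1) * (x (Suc i) k - x i k)"
    and k: "k \<in> {1..d}"
  shows "\<bar>poly_at d n (deriv_coeffs k a) (x 0)\<bar> * \<eta> \<le>
    2 * (\<rho> + real (card (multi_indices_upto d (Suc n))) * (\<Lambda> * ((real (Suc n))\<^sup>2 * R ^ Suc n * r\<^sup>2)))"
proof -
  let ?I = "multi_indices_upto d (Suc n)"
  define g where "g k = poly_at d n (deriv_coeffs k a) (x 0)" for k
  define lin where "lin i = (\<Sum>k\<in>{1..d}. g k * (x i k - x 0 k))" for i
  define e where "e i = poly_at d (Suc n) a (x i) - poly_at d (Suc n) a (x 0) - lin i" for i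
  let ?E = "real (card ?I) * (\<Lambda> * ((real (Suc n))\<^sup>2 * R ^ Suc n * r\<^sup>2))"
  have e: "\<bar>e i\<bar> \<le> ?E" if i: "i \<le> N" for i
  proof -
    let ?t = "\<lambda>\<alpha>. monomial_at (x i) \<alpha> - monomial_at (x 0) \<alpha> - monomial_diff (x 0) (\<lambda>k. x i k - x 0 k) \<alpha>"
    have "e i = (\<Sum>\<alpha>\<in>?I. a \<alpha> * ?t \<alpha>)"
      unfolding e_def lin_def g_def sum_monomial_diff[symmetric]
      by (simp add: poly_at_def right_diff_distrib sum_subtractf)
    also have "\<bar>\<dots>\<bar> \<le> (\<Sum>\<alpha>\<in>?I. \<bar>a \<alpha> * ?t \<alpha>\<bar>)" by (rule sum_abs)
    also have "\<dots> \<le> (\<Sum>\<alpha>\<in>?I. \<Lambda> * ((real (Suc n))\<^sup>2 * R ^ Suc n * r\<^sup>2))"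
    proof (rule sum_mono)
      fix \<alpha> assume \<alpha>: "\<alpha> \<in> ?I"
      then have sub: "\<And>k. k \<in># \<alpha> \<Longrightarrow> k \<in> {1..d}" and size: "size \<alpha> \<le> Suc n"
        by (auto simp: multi_indices_upto_def multi_indices_def)
      have "\<bar>?t \<alpha>\<bar> \<le> (real (size \<alpha>))\<^sup>2 * R ^ size \<alpha> * r\<^sup>2"
        using i sub by (intro monomial_taylor(2) R r xR xr) auto
      also have "\<dots> \<le> (real (Suc n))\<^sup>2 * R ^ Suc n * r\<^sup>2"
        using size R by (intro mult_right_mono mult_mono power_mono power_increasing) auto
      finally have "\<bar>?t \<alpha>\<bar> \<le> (real (Suc n))\<^sup>2 * R ^ Suc n * r\<^sup>2" .
      moreover have "\<bar>a \<alpha>\<bar> \<le> \<Lambda>" using a \<alpha> .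
      ultimately show "\<bar>a \<alpha> * ?t \<alpha>\<bar> \<le> \<Lambda> * ((real (Suc n))\<^sup>2 * R ^ Suc n * r\<^sup>2)"
        unfolding abs_mult by (intro mult_mono) auto
    qed
    finally show ?thesis by simp
  qed
  \<comment> \<open>choose increments whose signs agree with those of the gradient, so that no cancellation occurs\<close>
  define S where "S = {k\<in>{1..d}. 0 \<le> g k}"
  have "S \<subseteq> {1..d}" by (auto simp: S_def)
  from signs[OF this] obtain i where i: "i < N"
    and incr: "\<And>k. k \<in> {1..d} \<Longrightarrow> \<eta> \<le> (if k \<in> S then 1 else -1) * (x (Suc i) k - x i k)"
    by blast
  have "\<bar>g k\<bar> * \<eta> \<le> (\<Sum>k\<in>{1..d}. \<bar>g k\<bar> * \<eta>)"
    using k \<eta> by (intro member_le_sum) auto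
  also have "\<dots> \<le> (\<Sum>k\<in>{1..d}. g k * (x (Suc i) k - x i k))"
  proof (rule sum_mono)
    fix k assume k: "k \<in> {1..d}"
    have "\<bar>g k\<bar> * \<eta> \<le> \<bar>g k\<bar> * ((if k \<in> S then 1 else -1) * (x (Suc i) k - x i k))"
      using incr[OF k] by (rule mult_left_mono) simp
    also have "\<dots> = g k * (x (Suc i) k - x i k)"
      using k by (auto simp: S_def)
    finally show "\<bar>g k\<bar> * \<eta> \<le> g k * (x (Suc i) k - x i k)" .
  qed
  also have "\<dots> = lin (Suc i) - lin i"
    by (simp add: lin_def sum_subtractf[symmetric] algebra_simps)
  also have "\<dots> = (poly_at d (Suc n) a (x (Suc i)) - e (Suc i)) - (poly_at d (Suc n) a (x i) - e i)"
    by (simp add: e_def)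
  also have "\<dots> \<le> 2 * (\<rho> + ?E)"
  proof -
    have "i \<le> N" "Suc i \<le> N" using i by auto
    from small[OF this(1)] small[OF this(2)] e[OF this(1)] e[OF this(2)] show ?thesis
      unfolding abs_le_iff distrib_left by linarith
  qed
  finally show ?thesis by (simp add: g_def)
qed

section \<open>Grids and regular paths\<close>

definition grid_point :: "nat \<Rightarrow> nat \<Rightarrow> nat \<Rightarrow> real" where
  "grid_point q e j = real j / real q ^ e"

definition grid :: "nat \<Rightarrow> nat \<Rightarrow> real set" where
  "grid q e = grid_point q e ` {..<q ^ e}"

lemma grid_point_in_unit:
  assumes "j < q ^ e" shows "grid_point q e j \<in> {0..1}"
proof -
  have "real j < real (q ^ e)" using assms by (simp only: of_nat_less_iff)
  then have "real j < real q ^ e" by simp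
  then show ?thesis
    by (simp add: grid_point_def divide_le_eq)
qed

lemma grid_mono:
  assumes "e' \<le> e" "0 < q" shows "grid q e' \<subseteq> grid q e"
proof
  fix t assume "t \<in> grid q e'"
  then obtain l where l: "l < q ^ e'" "t = grid_point q e' l" by (auto simp: grid_def)
  have split: "q ^ e = q ^ e' * q ^ (e - e')" using assms by (simp flip: power_add)
  have "l * q ^ (e - e') < q ^ e" unfolding split using l assms by simp
  moreover have "t = grid_point q e (l * q ^ (e - e'))"
    using assms arg_cong[OF split, of real] by (simp add: l grid_point_def)
  ultimately show "t \<in> grid q e" by (auto simp: grid_def)
qed

lemma grid_approximates:
  assumes t: "t \<in> {0..1}" and q: "0 < q"
  obtains u where "u \<in> grid q e" "\<bar>t - u\<bar> \<le> 1 / real q ^ e"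
proof (cases "t = 1")
  case True
  have "q ^ e - 1 < q ^ e" using q by simp
  then have "grid_point q e (q ^ e - 1) \<in> grid q e" by (auto simp: grid_def)
  moreover have "\<bar>t - grid_point q e (q ^ e - 1)\<bar> \<le> 1 / real q ^ e"
  proof -
    have "real (q ^ e - 1) = real q ^ e - 1" using q by (simp add: Suc_le_eq)
    then show ?thesis using q True by (simp add: grid_point_def diff_divide_distrib)
  qed
  ultimately show ?thesis by (rule that)
next
  case False
  define j where "j = nat \<lfloor>t * real q ^ e\<rfloor>"
  have Q: "0 < real q ^ e" using q by simp
  have jt: "real j \<le> t * real q ^ e" "t * real q ^ e < real j + 1"
    using t Q by (simp_all add: j_def)
  moreover have "t * real q ^ e < 1 * real q ^ e"
    using False t Q by (intro mult_strict_right_mono) auto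
  ultimately have "real j < real q ^ e" by linarith
  then have "real j < real (q ^ e)" by (simp only: of_nat_power)
  then have "j < q ^ e" by (simp only: of_nat_less_iff)
  then have "grid_point q e j \<in> grid q e" by (auto simp: grid_def)
  moreover have "\<bar>t - grid_point q e j\<bar> \<le> 1 / real q ^ e"
  proof -
    have "t - grid_point q e j = (t * real q ^ e - real j) / real q ^ e"
      using Q by (simp add: grid_point_def diff_divide_distrib)
    moreover have "\<bar>t * real q ^ e - real j\<bar> \<le> 1" using jt by linarith
    ultimately show ?thesis using Q by (simp add: divide_right_mono)
  qed
  ultimately show ?thesis by (rule that)
qed

text \<open>The mesh \<open>1 / q ^ (2 * f)\<close> has an even exponent, so that \<open>1 / q ^
  f\<close> is the standard deviation of a Wiener increment over one step. The second clause
  allows increments of at most \<open>q\<close> standard deviations. The third one asks that in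
  every block of \<open>q\<close> consecutive grid points, and for every sign pattern, the
  \<open>d\<close> components have a common step with increments of these signs and at least one
  standard deviation.\<close>

definition regular_path :: "nat \<Rightarrow> nat \<Rightarrow> nat \<Rightarrow> (nat \<Rightarrow> real \<Rightarrow> real) \<Rightarrow> bool" where
  "regular_path d q f w \<longleftrightarrow>
    (\<forall>k\<in>{1..d}. w k 0 = 0) \<and>
    (\<forall>k\<in>{1..d}. \<forall>j<q ^ (2 * f). \<forall>i<j.
       (w k (grid_point q (2 * f) j) - w k (grid_point q (2 * f) i))\<^sup>2
         \<le> (real q)\<^sup>2 * (grid_point q (2 * f) j - grid_point q (2 * f) i)) \<and>
    (\<forall>S\<in>Pow {1..d}. \<forall>l<q ^ (2 * f - 1). \<exists>i<q - 1. \<forall>k\<in>{1..d}.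
       1 / real q ^ f \<le> (if k \<in> S then 1 else -1) *
         (w k (grid_point q (2 * f) (l * q + Suc i)) - w k (grid_point q (2 * f) (l * q + i))))"

lemma regular_path_increment:
  assumes "regular_path d q f w" "k \<in> {1..d}" "i \<le> j" "j < q ^ (2 * f)"
  shows "(w k (grid_point q (2 * f) j) - w k (grid_point q (2 * f) i))\<^sup>2
         \<le> (real q)\<^sup>2 * (grid_point q (2 * f) j - grid_point q (2 * f) i)"
  using assms by (cases "i = j") (auto simp: regular_path_def)

lemma regular_path_bound:
  assumes "regular_path d q f w" "k \<in> {1..d}" "j < q ^ (2 * f)"
  shows "\<bar>w k (grid_point q (2 * f) j)\<bar> \<le> real q"
proof -
  have "w k (grid_point q (2 * f) 0) = 0"
    using assms by (auto simp: regular_path_def grid_point_def)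
  then have "(w k (grid_point q (2 * f) j))\<^sup>2 \<le> (real q)\<^sup>2 * grid_point q (2 * f) j"
    using regular_path_increment[OF assms(1,2) _ assms(3), of 0] by (simp add: grid_point_def)
  also have "\<dots> \<le> (real q)\<^sup>2"
    using grid_point_in_unit[OF assms(3)] by (intro mult_left_le) auto
  finally have "\<bar>w k (grid_point q (2 * f) j)\<bar>\<^sup>2 \<le> (real q)\<^sup>2" by simp
  then show ?thesis by (rule power2_le_imp_le) simp
qed

lemma block_index_less:
  fixes l q e :: nat
  assumes "l < q ^ (e - 1)" "i < q" "0 < e"
  shows "l * q + i < q ^ e"
proof -
  have "l * q + i < Suc l * q" using assms by simp
  also have "\<dots> \<le> q ^ (e - 1) * q" using assms by (intro mult_right_mono) auto
  also have "\<dots> = q ^ e" using assms(3) by (rule power_minus_mult)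
  finally show ?thesis .
qed

section \<open>Induction on the degree along a regular path\<close>

text \<open>The parameters are chosen for \<open>\<epsilon>\<close> close to \<open>1 / q ^ (2 *
  slack m * 3 ^ (m + 1))\<close>. Then the thresholds for the Lipschitz norms and for the
  coefficients are close to \<open>q ^ (2 * slack m)\<close> and \<open>1 / q ^ (6 * slack
  m)\<close>. The value of \<open>slack m\<close> has to be large enough for
  \<open>half_exponent_bound\<close>.\<close>

definition slack :: "nat \<Rightarrow> nat" where
  "slack m = (m + 2)\<^sup>2 + m + 6"

text \<open>These exponents describe the polynomials that occur after \<open>m - n\<close>
  differentiations: they have degree \<open>n\<close>, are bounded by \<open>1 / q ^ (2 *
  half_exponent m n)\<close>, and are examined with mesh \<open>1 / q ^ (2 * mesh_exponent m
  n)\<close>. The mesh balances the smallness of the polynomial against coefficients of size about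
  \<open>q ^ (2 * slack m)\<close>, and since a differentiation costs a square root,
  \<open>half_exponent\<close> doubles with \<open>n\<close> up to an additive term. The initial
  value provides \<open>6 * slack m\<close>, the exponent wanted for the coefficients, and
  \<open>2 * (m + 2)\<^sup>2\<close> for the losses in solving for the coefficient of the empty
  multi-index.\<close>

primrec half_exponent :: "nat \<Rightarrow> nat \<Rightarrow> nat" where
  "half_exponent m 0 = 3 * slack m + (m + 2)\<^sup>2"
| "half_exponent m (Suc n) = 2 * half_exponent m n + slack m + m + 6"

definition mesh_exponent :: "nat \<Rightarrow> nat \<Rightarrow> nat" where
  "mesh_exponent m n = half_exponent m n + slack m + m + 4"

lemma half_exponent_mono: "half_exponent m 0 \<le> half_exponent m n"
  by (induction n) auto

text \<open>Doubling plus an additive term stays below tripling. At \<open>Suc n = m\<close> this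
  says that the smallness assumed of the original polynomial is enough to start the descent
  through the degrees.\<close>

lemma half_exponent_bound:
  "half_exponent m (Suc n) \<le> slack m * 3 ^ (Suc n + 1)"
proof (induction n)
  case 0
  show ?case by (simp add: slack_def)
next
  case (Suc n)
  have "slack m + m + 6 \<le> slack m * 3 * 1" by (simp add: slack_def)
  also have "\<dots> \<le> slack m * 3 * 3 ^ (Suc n)" by (intro mult_left_mono) simp_all
  finally show ?case using Suc by simp
qed

text \<open>The balance of scales in one differentiation: by the choice of the mesh, the errors
  from freezing the coefficients (the summand with the factor \<open>Q / Q ^ e\<close>) and from
  the second order terms (the summand with \<open>Q ^ 3 / Q ^ e\<close>) do not exceed the bound
  on the polynomial itself, and dividing by the typical increment leaves the bound for the next
  lower degree.\<close>

lemma scale_step: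
  fixes Q :: real
  assumes Q: "2 \<le> Q" and K: "K \<le> Q" "0 \<le> K" and mQ: "real m \<le> Q" and n: "Suc n \<le> m"
    and \<Lambda>: "\<Lambda> \<le> Q ^ (2 * slack m + 1 + m)" "0 \<le> \<Lambda>"
    and e: "e = 2 * mesh_exponent m (Suc n)"
    and G: "G * (1 / Q ^ mesh_exponent m (Suc n)) \<le>
      2 * ((1 / Q ^ (2 * half_exponent m (Suc n)) + K * (\<Lambda> * (Q / Q ^ e) * Q ^ Suc n)) +
           K * (\<Lambda> * ((real (Suc n))\<^sup>2 * Q ^ Suc n * (Q ^ 3 / Q ^ e))))"
  shows "G \<le> 1 / Q ^ (2 * half_exponent m n)"
proof -
  let ?h = "half_exponent m (Suc n)" and ?f = "mesh_exponent m (Suc n)"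
  let ?A = "2 * slack m + 1 + m"
  have Q1: "1 \<le> Q" and Q0: "0 < Q" using Q by auto
  have n2: "(real (Suc n))\<^sup>2 \<le> Q\<^sup>2" using n mQ by (intro power_mono) auto
  have Qn: "Q ^ Suc n \<le> Q ^ m" using n Q1 by (intro power_increasing) auto
  have "K * (\<Lambda> * (Q / Q ^ e) * Q ^ Suc n) + K * (\<Lambda> * ((real (Suc n))\<^sup>2 * Q ^ Suc n * (Q ^ 3 / Q ^ e)))
      = K * (\<Lambda> * (Q ^ Suc n * (Q + (real (Suc n))\<^sup>2 * Q ^ 3))) / Q ^ e"
    by (simp add: algebra_simps add_divide_distrib)
  also have "\<dots> \<le> Q * (Q ^ ?A * (Q ^ m * Q ^ 6)) / Q ^ e"
  proof -
    have "Q + (real (Suc n))\<^sup>2 * Q ^ 3 \<le> Q ^ 5 + Q\<^sup>2 * Q ^ 3"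
      using n2 Q1 self_le_power[of Q 5] by (intro add_mono mult_right_mono) auto
    also have "\<dots> = 2 * Q ^ 5" by (simp flip: power_add)
    also have "\<dots> \<le> Q * Q ^ 5" using Q by (intro mult_right_mono) auto
    finally have "Q + (real (Suc n))\<^sup>2 * Q ^ 3 \<le> Q ^ 6" by (simp flip: power_Suc)
    then show ?thesis
      using K \<Lambda> Qn Q0 by (intro divide_right_mono mult_mono) (auto intro!: add_nonneg_nonneg)
  qed
  also have "Q * (Q ^ ?A * (Q ^ m * Q ^ 6)) = Q ^ (?A + m + 7)"
    by (simp add: power_add mult_ac eval_nat_numeral)
  also have "\<dots> / Q ^ e = 1 / Q ^ (2 * ?h)"
  proof -
    have "e = (?A + m + 7) + 2 * ?h" unfolding e mesh_exponent_def by (simp del: half_exponent.simps)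
    then have "Q ^ e = Q ^ (?A + m + 7) * Q ^ (2 * ?h)" by (simp only: power_add)
    then show ?thesis using Q0 by (simp add: field_simps)
  qed
  finally have err: "K * (\<Lambda> * (Q / Q ^ e) * Q ^ Suc n)
      + K * (\<Lambda> * ((real (Suc n))\<^sup>2 * Q ^ Suc n * (Q ^ 3 / Q ^ e))) \<le> 1 / Q ^ (2 * ?h)" .
  have "G * (1 / Q ^ ?f) \<le> 4 * (1 / Q ^ (2 * ?h))"
  proof -
    let ?T = "K * (\<Lambda> * (Q / Q ^ e) * Q ^ Suc n)"
    let ?T' = "K * (\<Lambda> * ((real (Suc n))\<^sup>2 * Q ^ Suc n * (Q ^ 3 / Q ^ e)))"
    have "G * (1 / Q ^ ?f) \<le> 2 * (1 / Q ^ (2 * ?h) + (?T + ?T'))"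
      using G by (simp only: add.assoc)
    also have "\<dots> \<le> 2 * (1 / Q ^ (2 * ?h) + 1 / Q ^ (2 * ?h))"
      by (rule mult_left_mono[OF add_left_mono[OF err]]) simp
    finally show ?thesis by simp
  qed
  also have "\<dots> \<le> Q\<^sup>2 * (1 / Q ^ (2 * ?h))"
    using power_mono[OF Q, of 2] Q0 by (intro mult_right_mono) auto
  finally have "G \<le> Q\<^sup>2 * (1 / Q ^ (2 * ?h)) * Q ^ ?f"
    using Q0 by (simp add: field_simps)
  also have "\<dots> = Q ^ (?f + 2) / Q ^ (2 * ?h)" by (simp add: power_add power2_eq_square)
  also have "Q ^ (2 * ?h) = Q ^ (?f + 2) * Q ^ (2 * half_exponent m n)"
  proof -
    have "2 * ?h = (?f + 2) + 2 * half_exponent m n" by (simp add: mesh_exponent_def)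
    then show ?thesis by (simp only: power_add)
  qed
  finally show ?thesis using Q0 by (simp add: power2_eq_square)
qed

text \<open>Differentiation multiplies a coefficient by at most \<open>m \<le> q\<close>, so the
  bound on the coefficients and their Lipschitz constants may grow by one factor \<open>q\<close>
  per degree; solving for the coefficient of the empty multi-index loses at most \<open>m +
  2\<close> powers of \<open>q\<close>. Every block of the grid for degree \<open>Suc n\<close>
  yields a bound on the gradient at its starting point, and these starting points contain the grid
  for degree \<open>n\<close>.\<close>

lemma small_coefficients:
  fixes A :: "nat multiset \<Rightarrow> real \<Rightarrow> real" and w :: "nat \<Rightarrow> real \<Rightarrow> real"
  assumes q: "2 \<le> q" "card (multi_indices_upto d m) \<le> q" "m \<le> q"
    and regular: "\<And>n. n \<le> m \<Longrightarrow> regular_path d q (mesh_exponent m n) w"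
    and n: "n \<le> m"
    and bound: "\<And>\<alpha> t. \<alpha> \<in> multi_indices_upto d n \<Longrightarrow> t \<in> {0..1} \<Longrightarrow>
      \<bar>A \<alpha> t\<bar> \<le> real q ^ (2 * slack m + 1 + (m - n))"
    and lip: "\<And>\<alpha> s t. \<alpha> \<in> multi_indices_upto d n \<Longrightarrow> s \<in> {0..1} \<Longrightarrow> t \<in> {0..1} \<Longrightarrow>
      \<bar>A \<alpha> t - A \<alpha> s\<bar> \<le> real q ^ (2 * slack m + 1 + (m - n)) * \<bar>t - s\<bar>"
    and small: "\<And>t. t \<in> grid q (2 * mesh_exponent m n) \<Longrightarrow>
      \<bar>poly_at d n (\<lambda>\<alpha>. A \<alpha> t) (\<lambda>k. w k t)\<bar> \<le> 1 / real q ^ (2 * half_exponent m n)"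
    and \<alpha>: "\<alpha> \<in> multi_indices_upto d n" and t: "t \<in> grid q (2 * mesh_exponent m 0)"
  shows "\<bar>A \<alpha> t\<bar> \<le> 1 / real q ^ (6 * slack m + 2 + (m - n) * (m + 2))"
  using n bound lip small \<alpha> t
proof (induction n arbitrary: A \<alpha> t)
  case 0
  have "\<bar>A \<alpha> t\<bar> \<le> 1 / real q ^ (2 * half_exponent m 0)"
    using "0.prems"(4)[of t] "0.prems"(5,6) by (simp add: poly_at_def multi_indices_upto_0)
  also have "\<dots> \<le> 1 / real q ^ (6 * slack m + 2 + (m - 0) * (m + 2))"
    using q(1) by (intro divide_left_mono power_increasing) (auto simp: power2_eq_square algebra_simps)
  finally show ?case .
next
  case (Suc n A)
  let ?Q = "real q" and ?I = "multi_indices_upto d (Suc n)"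
  let ?f = "mesh_exponent m (Suc n)"
  let ?\<Lambda> = "?Q ^ (2 * slack m + 1 + (m - Suc n))"
  let ?K = "real (card ?I)"
  have nm: "Suc n \<le> m" by fact
  have Q1: "1 \<le> ?Q" and Q2: "2 \<le> ?Q" and q0: "0 < q" using q by auto
  have reg: "regular_path d q ?f w" using regular nm by blast
  have f0: "0 < 2 * ?f" by (simp add: mesh_exponent_def)
  have I_mono: "?I \<subseteq> multi_indices_upto d m" using nm by (auto simp: multi_indices_upto_def)
  then have K: "?K \<le> ?Q" using q(2) card_mono[OF finite_multi_indices_upto I_mono] by simp
  have \<Lambda>_Suc: "?Q * ?\<Lambda> = ?Q ^ (2 * slack m + 1 + (m - n))"
    using nm by (simp flip: power_Suc add: Suc_diff_Suc)
  have add_in_I: "add_mset k \<beta> \<in> ?I" if "\<beta> \<in> multi_indices_upto d n" "k \<in> {1..d}" for k \<beta>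
    using that by (auto simp: multi_indices_upto_def multi_indices_def)
  have mult_le: "real (Suc (count \<beta> k)) \<le> ?Q" if "\<beta> \<in> multi_indices_upto d n" for k \<beta>
  proof -
    have "Suc (count \<beta> k) \<le> q"
      using that count_le_size[of \<beta> k] nm q(3) by (simp add: multi_indices_upto_def)
    then show ?thesis by (simp only: of_nat_le_iff)
  qed
  have deriv_small: "\<bar>poly_at d n (\<lambda>\<beta>. deriv_coeffs k (\<lambda>\<alpha>. A \<alpha> u) \<beta>) (\<lambda>k. w k u)\<bar>
      \<le> 1 / ?Q ^ (2 * half_exponent m n)"
    if k: "k \<in> {1..d}" and u: "u \<in> grid q (2 * mesh_exponent m n)" for k u
  proof -
    have "2 * mesh_exponent m n \<le> 2 * ?f - 1" by (simp add: mesh_exponent_def)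
    from grid_mono[OF this q0] u obtain l where l: "l < q ^ (2 * ?f - 1)"
      and ul: "u = grid_point q (2 * ?f - 1) l" by (auto simp: grid_def)
    define \<tau> where "\<tau> i = grid_point q (2 * ?f) (l * q + i)" for i
    define x where "x i k = w k (\<tau> i)" for i k
    have Qf: "?Q ^ (2 * ?f) = ?Q ^ (2 * ?f - 1) * ?Q"
      using f0 by (metis Suc_diff_1 power_Suc2)
    have u: "u = \<tau> 0"
      using q0 unfolding ul \<tau>_def grid_point_def Qf by simp
    have idx: "l * q + i < q ^ (2 * ?f)" if "i < q" for i
      using block_index_less[OF l that f0] .
    have \<tau>01: "\<tau> i \<in> {0..1}" if "i < q" for i
      unfolding \<tau>_def by (rule grid_point_in_unit[OF idx[OF that]])
    have \<tau>grid: "\<tau> i \<in> grid q (2 * ?f)" if "i < q" for i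
      using idx[OF that] by (auto simp: grid_def \<tau>_def)
    have \<tau>dist: "\<tau> i - \<tau> 0 \<le> ?Q / ?Q ^ (2 * ?f)" "0 \<le> \<tau> i - \<tau> 0" if "i < q" for i
      using that q0 by (auto simp: \<tau>_def grid_point_def add_divide_distrib intro!: divide_right_mono)
    define r where "r = sqrt (?Q ^ 3 / ?Q ^ (2 * ?f))"
    have r2: "r\<^sup>2 = ?Q ^ 3 / ?Q ^ (2 * ?f)" using q0 by (simp add: r_def)
    have xr: "\<bar>x i j - x 0 j\<bar> \<le> r" if "i < q" "j \<in> {1..d}" for i j
    proof -
      have "(x i j - x 0 j)\<^sup>2 \<le> ?Q\<^sup>2 * (\<tau> i - \<tau> 0)"
        unfolding x_def \<tau>_def by (intro regular_path_increment[OF reg that(2)] idx that) simp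
      also have "\<dots> \<le> ?Q\<^sup>2 * (?Q / ?Q ^ (2 * ?f))"
        using \<tau>dist that by (intro mult_left_mono) auto
      also have "\<dots> = r\<^sup>2" unfolding r2 by (simp add: power2_eq_square power3_eq_cube)
      finally have "\<bar>x i j - x 0 j\<bar>\<^sup>2 \<le> r\<^sup>2" by simp
      then show ?thesis by (rule power2_le_imp_le) (simp add: r_def)
    qed
    have xR: "\<bar>x i j\<bar> \<le> ?Q" if "i < q" "j \<in> {1..d}" for i j
      unfolding x_def \<tau>_def by (rule regular_path_bound[OF reg that(2) idx[OF that(1)]])
    \<comment> \<open>replacing the coefficients by their values at the start of the block costs little\<close>
    have frozen: "\<bar>poly_at d (Suc n) (\<lambda>\<alpha>. A \<alpha> u) (x i)\<bar> \<le>
        1 / ?Q ^ (2 * half_exponent m (Suc n)) + ?K * (?\<Lambda> * (?Q / ?Q ^ (2 * ?f)) * ?Q ^ Suc n)"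
      if i: "i < q" for i
    proof -
      have "poly_at d (Suc n) (\<lambda>\<alpha>. A \<alpha> u) (x i) - poly_at d (Suc n) (\<lambda>\<alpha>. A \<alpha> (\<tau> i)) (x i)
          = (\<Sum>\<alpha>\<in>?I. (A \<alpha> u - A \<alpha> (\<tau> i)) * monomial_at (x i) \<alpha>)"
        by (simp add: poly_at_def sum_subtractf[symmetric] algebra_simps)
      also have "\<bar>\<dots>\<bar> \<le> (\<Sum>\<alpha>\<in>?I. \<bar>(A \<alpha> u - A \<alpha> (\<tau> i)) * monomial_at (x i) \<alpha>\<bar>)"
        by (rule sum_abs)
      also have "\<dots> \<le> (\<Sum>\<alpha>\<in>?I. ?\<Lambda> * (?Q / ?Q ^ (2 * ?f)) * ?Q ^ Suc n)"
        unfolding abs_mult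
      proof (intro sum_mono mult_mono)
        fix \<alpha> assume \<alpha>: "\<alpha> \<in> ?I"
        have "\<bar>A \<alpha> u - A \<alpha> (\<tau> i)\<bar> \<le> ?\<Lambda> * \<bar>u - \<tau> i\<bar>"
          using Suc.prems(3)[OF \<alpha>] \<tau>01 i q0 u by simp
        also have "\<dots> \<le> ?\<Lambda> * (?Q / ?Q ^ (2 * ?f))"
          using \<tau>dist[OF i] u by (intro mult_left_mono) auto
        finally show "\<bar>A \<alpha> u - A \<alpha> (\<tau> i)\<bar> \<le> ?\<Lambda> * (?Q / ?Q ^ (2 * ?f))" .
        have "\<bar>monomial_at (x i) \<alpha>\<bar> \<le> ?Q ^ size \<alpha>"
          using \<alpha> xR i Q1
          by (intro monomial_at_bound) (auto simp: multi_indices_upto_def multi_indices_def)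
        also have "\<dots> \<le> ?Q ^ Suc n"
          using \<alpha> Q1 by (intro power_increasing) (auto simp: multi_indices_upto_def)
        finally show "\<bar>monomial_at (x i) \<alpha>\<bar> \<le> ?Q ^ Suc n" .
      qed auto
      finally have "\<bar>poly_at d (Suc n) (\<lambda>\<alpha>. A \<alpha> u) (x i) - poly_at d (Suc n) (\<lambda>\<alpha>. A \<alpha> (\<tau> i)) (x i)\<bar>
          \<le> ?K * (?\<Lambda> * (?Q / ?Q ^ (2 * ?f)) * ?Q ^ Suc n)" by simp
      moreover have "\<bar>poly_at d (Suc n) (\<lambda>\<alpha>. A \<alpha> (\<tau> i)) (x i)\<bar> \<le> 1 / ?Q ^ (2 * half_exponent m (Suc n))"
        using Suc.prems(4)[OF \<tau>grid[OF i]] unfolding x_def .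
      ultimately show ?thesis by linarith
    qed
    have "\<bar>poly_at d n (deriv_coeffs k (\<lambda>\<alpha>. A \<alpha> u)) (x 0)\<bar> * (1 / ?Q ^ ?f) \<le>
      2 * ((1 / ?Q ^ (2 * half_exponent m (Suc n)) + ?K * (?\<Lambda> * (?Q / ?Q ^ (2 * ?f)) * ?Q ^ Suc n)) +
           ?K * (?\<Lambda> * ((real (Suc n))\<^sup>2 * ?Q ^ Suc n * r\<^sup>2)))"
    proof (rule gradient_bound_by_increments[where N = "q - 1"])
      show "\<bar>A \<alpha> u\<bar> \<le> ?\<Lambda>" if "\<alpha> \<in> ?I" for \<alpha>
        using Suc.prems(2)[OF that] \<tau>01[of 0] q0 u by simp
      show "\<exists>i<q - 1. \<forall>k\<in>{1..d}. 1 / ?Q ^ ?f \<le> (if k \<in> S then 1 else -1) * (x (Suc i) k - x i k)"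
        if "S \<subseteq> {1..d}" for S
        using reg that l unfolding regular_path_def x_def \<tau>_def by blast
      show "0 \<le> r" by (simp add: r_def)
    qed (use q0 Q1 k xr xR frozen in auto)
    then have "\<bar>poly_at d n (deriv_coeffs k (\<lambda>\<alpha>. A \<alpha> u)) (x 0)\<bar> \<le> 1 / ?Q ^ (2 * half_exponent m n)"
      unfolding r2 using Q2 K q(3) nm
      by (intro scale_step[where K = ?K and \<Lambda> = ?\<Lambda> and m = m]) (auto intro!: power_increasing simp del: half_exponent.simps)
    moreover have "x 0 = (\<lambda>k. w k u)" unfolding u x_def ..
    ultimately show ?thesis by simp
  qed
  have nonempty_small: "\<bar>A \<alpha> u\<bar> \<le> 1 / ?Q ^ (6 * slack m + 2 + (m - n) * (m + 2))"
    if \<alpha>: "\<alpha> \<in> ?I" "\<alpha> \<noteq> {#}" and u: "u \<in> grid q (2 * mesh_exponent m 0)" for \<alpha> u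
  proof -
    from \<alpha> obtain k \<beta> where k\<beta>: "\<alpha> = add_mset k \<beta>" by (meson multiset_cases)
    with \<alpha> have k: "k \<in> {1..d}" and \<beta>: "\<beta> \<in> multi_indices_upto d n"
      by (auto simp: multi_indices_upto_def multi_indices_def)
    let ?B = "\<lambda>\<beta> t. deriv_coeffs k (\<lambda>\<alpha>. A \<alpha> t) \<beta>"
    have "\<bar>?B \<beta> u\<bar> \<le> 1 / ?Q ^ (6 * slack m + 2 + (m - n) * (m + 2))"
    proof (rule Suc.IH[of ?B])
      fix \<beta> s t assume \<beta>: "\<beta> \<in> multi_indices_upto d n" and t: "t \<in> {0..1::real}"
      have "\<bar>?B \<beta> t\<bar> = real (Suc (count \<beta> k)) * \<bar>A (add_mset k \<beta>) t\<bar>"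
        unfolding deriv_coeffs_def abs_mult by simp
      also have "\<dots> \<le> ?Q * ?\<Lambda>"
        using Suc.prems(2)[OF add_in_I[OF \<beta> k] t] mult_le[OF \<beta>] by (intro mult_mono) auto
      finally show "\<bar>?B \<beta> t\<bar> \<le> ?Q ^ (2 * slack m + 1 + (m - n))" unfolding \<Lambda>_Suc .
      assume s: "s \<in> {0..1::real}"
      have "\<bar>?B \<beta> t - ?B \<beta> s\<bar> = real (Suc (count \<beta> k)) * \<bar>A (add_mset k \<beta>) t - A (add_mset k \<beta>) s\<bar>"
        unfolding deriv_coeffs_def right_diff_distrib[symmetric] abs_mult by simp
      also have "\<dots> \<le> ?Q * (?\<Lambda> * \<bar>t - s\<bar>)"
        using Suc.prems(3)[OF add_in_I[OF \<beta> k] s t] mult_le[OF \<beta>] by (intro mult_mono) auto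
      finally show "\<bar>?B \<beta> t - ?B \<beta> s\<bar> \<le> ?Q ^ (2 * slack m + 1 + (m - n)) * \<bar>t - s\<bar>"
        unfolding \<Lambda>_Suc[symmetric] by (simp only: mult.assoc)
    qed (use nm deriv_small[OF k] \<beta> u in auto)
    moreover have "\<bar>A \<alpha> u\<bar> \<le> \<bar>?B \<beta> u\<bar>"
      unfolding deriv_coeffs_def k\<beta> abs_mult by (simp add: mult_le_cancel_right1)
    ultimately show ?thesis by linarith
  qed
  have exps: "6 * slack m + 2 + (m - n) * (m + 2) = 6 * slack m + 2 + (m - Suc n) * (m + 2) + (m + 2)"
  proof -
    have "m - n = Suc (m - Suc n)" using nm by simp
    then show ?thesis by simp
  qed
  show ?case
  proof (cases "\<alpha> = {#}")
    case False
    then have "\<bar>A \<alpha> t\<bar> \<le> 1 / ?Q ^ (6 * slack m + 2 + (m - n) * (m + 2))"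
      using nonempty_small Suc.prems by blast
    also have "\<dots> \<le> 1 / ?Q ^ (6 * slack m + 2 + (m - Suc n) * (m + 2))"
      unfolding exps using Q1 by (intro divide_left_mono power_increasing) auto
    finally show ?thesis .
  next
    case True
    let ?C = "6 * slack m + 2 + (m - Suc n) * (m + 2)"
    have f_mono: "2 * mesh_exponent m 0 \<le> 2 * ?f"
      using half_exponent_mono[of m "Suc n"] by (simp add: mesh_exponent_def del: half_exponent.simps)
    have tg: "t \<in> grid q (2 * ?f)" using grid_mono[OF f_mono q0] Suc.prems(6) by auto
    have wR: "\<bar>w k t\<bar> \<le> ?Q" if "k \<in> {1..d}" for k
      using tg regular_path_bound[OF reg that] by (auto simp: grid_def)
    \<comment> \<open>the coefficient of the empty multi-index is what the other terms leave of the polynomial\<close>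
    let ?R = "\<Sum>\<alpha>\<in>?I - {{#}}. A \<alpha> t * monomial_at (\<lambda>k. w k t) \<alpha>"
    have "poly_at d (Suc n) (\<lambda>\<alpha>. A \<alpha> t) (\<lambda>k. w k t) = A {#} t + ?R"
      unfolding poly_at_def by (subst sum.remove[of _ "{#}"]) auto
    then have "\<bar>A {#} t\<bar> \<le> 1 / ?Q ^ (2 * half_exponent m (Suc n)) + \<bar>?R\<bar>"
      using Suc.prems(4)[OF tg] by linarith
    also have "\<bar>?R\<bar> \<le> (\<Sum>\<alpha>\<in>?I - {{#}}. \<bar>A \<alpha> t * monomial_at (\<lambda>k. w k t) \<alpha>\<bar>)"
      by (rule sum_abs)
    also have "\<dots> \<le> (\<Sum>\<alpha>\<in>?I - {{#}}. 1 / ?Q ^ (?C + (m + 2)) * ?Q ^ m)"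
      unfolding abs_mult
    proof (intro sum_mono mult_mono)
      fix \<alpha> assume \<alpha>: "\<alpha> \<in> ?I - {{#}}"
      show "\<bar>A \<alpha> t\<bar> \<le> 1 / ?Q ^ (?C + (m + 2))"
        using nonempty_small[of \<alpha> t] \<alpha> Suc.prems(6) unfolding exps by blast
      have "\<bar>monomial_at (\<lambda>k. w k t) \<alpha>\<bar> \<le> ?Q ^ size \<alpha>"
        using \<alpha> wR Q1 by (intro monomial_at_bound) (auto simp: multi_indices_upto_def multi_indices_def)
      also have "\<dots> \<le> ?Q ^ m"
        using \<alpha> Q1 nm by (intro power_increasing) (auto simp: multi_indices_upto_def)
      finally show "\<bar>monomial_at (\<lambda>k. w k t) \<alpha>\<bar> \<le> ?Q ^ m" .
    qed auto
    also have "\<dots> \<le> ?Q * (1 / ?Q ^ (?C + (m + 2)) * ?Q ^ m)"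
    proof -
      have "real (card (?I - {{#}})) \<le> ?K" by (simp add: card_mono)
      then have "real (card (?I - {{#}})) \<le> ?Q" using K by linarith
      then show ?thesis by (simp only: sum_constant) (intro mult_right_mono, auto)
    qed
    also have "\<dots> = 1 / ?Q ^ (?C + 1)"
      using q0 by (simp add: power_add field_simps power2_eq_square)
    also have "1 / ?Q ^ (2 * half_exponent m (Suc n)) \<le> 1 / ?Q ^ (?C + 1)"
    proof -
      have "(m - Suc n) * (m + 2) \<le> m * (m + 2)" by (intro mult_right_mono) auto
      then have "?C + 1 \<le> 2 * half_exponent m 0" by (simp add: power2_eq_square algebra_simps)
      also have "\<dots> \<le> 2 * half_exponent m (Suc n)" using half_exponent_mono[of m "Suc n"] by (simp del: half_exponent.simps)
      finally show ?thesis using q0 Q1 by (intro divide_left_mono power_increasing) auto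
    qed
    finally have "\<bar>A {#} t\<bar> \<le> 2 * (1 / ?Q ^ (?C + 1))" by simp
    also have "\<dots> \<le> ?Q * (1 / ?Q ^ (?C + 1))" using Q2 by (intro mult_right_mono) auto
    also have "\<dots> = 1 / ?Q ^ ?C" using q0 by simp
    finally show ?thesis using True by simp
  qed
qed

text \<open>Translation from powers of \<open>q\<close> to powers of the real number
  \<open>y\<close> that \<open>q\<close> approximates, and from the coarsest grid to all times: a
  factor \<open>2 ^ (6 * slack m) \<le> q\<close> covers the difference between \<open>q\<close>
  and \<open>y\<close>, and the coefficients cannot change much within one mesh width.\<close>

lemma coefficients_small_on_regular_path:
  fixes A :: "nat multiset \<Rightarrow> real \<Rightarrow> real" and w :: "nat \<Rightarrow> real \<Rightarrow> real"
  assumes m: "0 < m"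
    and q: "card (multi_indices_upto d m) \<le> q" "m \<le> q" "2 ^ (6 * slack m) \<le> q"
    and regular: "\<And>n. n \<le> m \<Longrightarrow> regular_path d q (mesh_exponent m n) w"
    and y: "real q \<le> y" "y \<le> 2 * real q"
    and bound: "\<And>\<alpha> t. \<alpha> \<in> multi_indices_upto d m \<Longrightarrow> t \<in> {0..1} \<Longrightarrow> \<bar>A \<alpha> t\<bar> \<le> y ^ (2 * slack m)"
    and lip: "\<And>\<alpha> s t. \<alpha> \<in> multi_indices_upto d m \<Longrightarrow> s \<in> {0..1} \<Longrightarrow> t \<in> {0..1} \<Longrightarrow>
      \<bar>A \<alpha> t - A \<alpha> s\<bar> \<le> y ^ (2 * slack m) * \<bar>t - s\<bar>"
    and small: "\<And>t. t \<in> {0..1} \<Longrightarrow>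
      \<bar>poly_at d m (\<lambda>\<alpha>. A \<alpha> t) (\<lambda>k. w k t)\<bar> \<le> 1 / y ^ (2 * slack m * 3 ^ (m + 1))"
    and \<alpha>: "\<alpha> \<in> multi_indices_upto d m" and t: "t \<in> {0..1}"
  shows "\<bar>A \<alpha> t\<bar> \<le> 1 / y ^ (6 * slack m)"
proof -
  let ?s = "slack m" and ?Q = "real q"
  have s: "6 \<le> ?s" by (simp add: slack_def)
  have "(2::nat) ^ 1 \<le> 2 ^ (6 * ?s)" using s by (intro power_increasing) auto
  then have q2: "2 \<le> q" using q(3) by simp
  then have Q: "2 \<le> ?Q" "1 \<le> ?Q" "0 < ?Q" "0 < q" by auto
  have y_pos: "0 < y" using y Q by linarith
  have two_pow: "(2::real) ^ j \<le> ?Q" if "j \<le> 6 * ?s" for j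
  proof -
    have "(2::nat) ^ j \<le> 2 ^ (6 * ?s)" using that by (intro power_increasing) auto
    then have "real (2 ^ j) \<le> real q" using q(3) by (simp only: of_nat_le_iff)
    then show ?thesis by simp
  qed
  have y_pow: "y ^ j \<le> ?Q ^ Suc j" if "j \<le> 6 * ?s" for j
  proof -
    have "y ^ j \<le> (2 * ?Q) ^ j" using y y_pos by (intro power_mono) auto
    also have "\<dots> = 2 ^ j * ?Q ^ j" by (rule power_mult_distrib)
    also have "\<dots> \<le> ?Q * ?Q ^ j" using two_pow[OF that] Q by (intro mult_right_mono) auto
    finally show ?thesis by simp
  qed
  have L: "y ^ (2 * ?s) \<le> ?Q ^ (2 * ?s + 1)" using y_pow[of "2 * ?s"] by simp
  let ?e = "2 * mesh_exponent m 0"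
  have small': "\<bar>poly_at d m (\<lambda>\<alpha>. A \<alpha> u) (\<lambda>k. w k u)\<bar> \<le> 1 / ?Q ^ (2 * half_exponent m m)"
    if "u \<in> {0..1}" for u
  proof -
    have "2 * half_exponent m m \<le> 2 * ?s * 3 ^ (m + 1)"
      using half_exponent_bound[of m "m - 1"] m by (simp del: half_exponent.simps)
    then have "?Q ^ (2 * half_exponent m m) \<le> ?Q ^ (2 * ?s * 3 ^ (m + 1))"
      using Q(2) by (rule power_increasing)
    also have "\<dots> \<le> y ^ (2 * ?s * 3 ^ (m + 1))" using y by (intro power_mono) auto
    finally have "1 / y ^ (2 * ?s * 3 ^ (m + 1)) \<le> 1 / ?Q ^ (2 * half_exponent m m)"
      using Q y_pos by (intro divide_left_mono) auto
    with small[OF that] show ?thesis by linarith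
  qed
  obtain u where u: "u \<in> grid q ?e" "\<bar>t - u\<bar> \<le> 1 / ?Q ^ ?e"
    using grid_approximates[OF t \<open>0 < q\<close>] by blast
  have u01: "u \<in> {0..1}" using u(1) grid_point_in_unit by (auto simp: grid_def)
  have "\<bar>A \<alpha> u\<bar> \<le> 1 / ?Q ^ (6 * ?s + 2 + (m - m) * (m + 2))"
  proof (rule small_coefficients[OF q2 q(1,2) regular order.refl _ _ _ \<alpha> u(1)])
    fix \<beta> v assume \<beta>: "\<beta> \<in> multi_indices_upto d m" and v: "v \<in> {0..1::real}"
    show "\<bar>A \<beta> v\<bar> \<le> ?Q ^ (2 * ?s + 1 + (m - m))" using bound[OF \<beta> v] L by simp
    fix v' assume v': "v' \<in> {0..1::real}"
    have "y ^ (2 * ?s) * \<bar>v - v'\<bar> \<le> ?Q ^ (2 * ?s + 1) * \<bar>v - v'\<bar>"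
      using L by (rule mult_right_mono) simp
    with lip[OF \<beta> v' v] show "\<bar>A \<beta> v - A \<beta> v'\<bar> \<le> ?Q ^ (2 * ?s + 1 + (m - m)) * \<bar>v - v'\<bar>" by simp
  next
    fix v assume "v \<in> grid q (2 * mesh_exponent m m)"
    then have "v \<in> {0..1}" using grid_point_in_unit by (auto simp: grid_def)
    then show "\<bar>poly_at d m (\<lambda>\<alpha>. A \<alpha> v) (\<lambda>k. w k v)\<bar> \<le> 1 / ?Q ^ (2 * half_exponent m m)"
      by (rule small')
  qed
  moreover have "\<bar>A \<alpha> t - A \<alpha> u\<bar> \<le> 1 / ?Q ^ (6 * ?s + 2)"
  proof -
    have "\<bar>A \<alpha> t - A \<alpha> u\<bar> \<le> y ^ (2 * ?s) * \<bar>t - u\<bar>" using lip[OF \<alpha> u01 t] .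
    also have "\<dots> \<le> ?Q ^ (2 * ?s + 1) * (1 / ?Q ^ ?e)" using L u(2) by (intro mult_mono) auto
    also have "\<dots> \<le> ?Q ^ (2 * ?s + 1) * (1 / ?Q ^ ((2 * ?s + 1) + (6 * ?s + 2)))"
      using Q by (intro mult_left_mono divide_left_mono power_increasing) (auto simp: mesh_exponent_def)
    also have "\<dots> = 1 / ?Q ^ (6 * ?s + 2)"
      unfolding power_add[of ?Q "2 * ?s + 1"] using Q by simp
    finally show ?thesis .
  qed
  ultimately have "\<bar>A \<alpha> t\<bar> \<le> 2 * (1 / ?Q ^ (6 * ?s + 2))" by simp
  also have "\<dots> \<le> ?Q * (1 / ?Q ^ (6 * ?s + 2))" using Q by (intro mult_right_mono) auto
  also have "\<dots> = 1 / ?Q ^ Suc (6 * ?s)" using Q by simp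
  also have "\<dots> \<le> 1 / y ^ (6 * ?s)"
    using y_pow[of "6 * ?s"] y_pos Q by (intro divide_left_mono) auto
  finally show ?thesis .
qed

section \<open>Increments of Wiener processes\<close>

lemma (in prob_space) std_normal_tail_bound:
  assumes X: "distributed M lborel X std_normal_density" and x: "0 < x"
  shows "prob {\<omega> \<in> space M. x < \<bar>X \<omega>\<bar>} \<le> (fact (2 * j) / (2 ^ j * fact j)) / x ^ (2 * j)"
proof -
  have [measurable]: "random_variable borel X"
    using distributed_measurable[OF X] by simp
  have int: "integrable M (\<lambda>\<omega>. X \<omega> ^ (2 * j))"
    using distributed_integrable[OF X, of "\<lambda>x. x ^ (2 * j)"] integrable_std_normal_moment[of "2 * j"]
    by (simp add: normal_density_nonneg)
  have "prob {\<omega> \<in> space M. x < \<bar>X \<omega>\<bar>} \<le> prob {\<omega> \<in> space M. x ^ (2 * j) \<le> X \<omega> ^ (2 * j)}"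
  proof (rule finite_measure_mono)
    show "{\<omega> \<in> space M. x < \<bar>X \<omega>\<bar>} \<subseteq> {\<omega> \<in> space M. x ^ (2 * j) \<le> X \<omega> ^ (2 * j)}"
    proof clarsimp
      fix \<omega> assume "x < \<bar>X \<omega>\<bar>"
      then have "x ^ (2 * j) \<le> \<bar>X \<omega>\<bar> ^ (2 * j)" using x by (intro power_mono) auto
      then show "x ^ (2 * j) \<le> X \<omega> ^ (2 * j)" by (simp add: power_even_abs)
    qed
  qed measurable
  also have "\<dots> \<le> expectation (\<lambda>\<omega>. X \<omega> ^ (2 * j)) / x ^ (2 * j)"
    using x by (intro integral_Markov_inequality_measure[where A = "space M"] int) auto
  also have "expectation (\<lambda>\<omega>. X \<omega> ^ (2 * j)) = fact (2 * j) / (2 ^ j * fact j)"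
    using distributed_integral[OF X, of "\<lambda>x. x ^ (2 * j)"] integral_std_normal_moment_even[of j]
    by (simp add: normal_density_nonneg)
  finally show ?thesis .
qed

definition normal_tail :: real where
  "normal_tail = measure (density lborel std_normal_density) {1..}"

lemma (in prob_space) prob_std_normal_ge_one:
  assumes X: "distributed M lborel X std_normal_density"
  shows "prob {\<omega> \<in> space M. 1 \<le> X \<omega>} = normal_tail"
proof -
  have rv: "random_variable lborel X"
    using distributed_measurable[OF X] .
  have "normal_tail = measure (distr M lborel X) {1..}"
    unfolding normal_tail_def distributed_distr_eq_density[OF X] ..
  also have "\<dots> = prob {\<omega> \<in> space M. 1 \<le> X \<omega>}"
    using rv by (subst measure_distr) (auto intro!: arg_cong[where f = prob])
  finally show ?thesis ..
qed

lemma normal_tail_pos: "0 < normal_tail" and normal_tail_le_1: "normal_tail \<le> 1"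
proof -
  interpret N: prob_space "density lborel std_normal_density"
    using prob_space_normal_density[of 1 0] by simp
  show "normal_tail \<le> 1" by (simp add: normal_tail_def)
  have "emeasure (density lborel std_normal_density) {1..} \<noteq> 0"
  proof
    assume "emeasure (density lborel std_normal_density) {1..} = 0"
    then have "AE x in lborel. std_normal_density x * indicator {1..} x = 0"
      by (subst (asm) emeasure_density)
        (auto simp: nn_integral_0_iff_AE ennreal_mult'[symmetric] ennreal_indicator[symmetric])
    then have "AE x in lborel. x \<notin> {1..2::real}"
    proof eventually_elim
      case (elim x)
      have "0 < std_normal_density x" by (rule normal_density_pos) simp
      with elim show ?case by (auto simp: indicator_def)
    qed
    then have "{1..2::real} \<in> null_sets lborel"
      by (subst AE_iff_null_sets) auto
    then show False by (simp add: null_sets_def)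
  qed
  then show "0 < normal_tail"
    by (simp add: normal_tail_def N.emeasure_eq_measure zero_less_measure_iff)
qed

lemma (in prob_space) std_normal_signed_increment:
  assumes W: "standard_wiener W" and st: "0 \<le> s" "s < t" "t \<le> 1" and \<sigma>: "\<bar>\<sigma>\<bar> = 1"
  shows "distributed M lborel (\<lambda>\<omega>. \<sigma> / sqrt (t - s) * (W t \<omega> - W s \<omega>)) std_normal_density"
proof -
  have "distributed M lborel (\<lambda>\<omega>. W t \<omega> - W s \<omega>) (\<lambda>x. ennreal (normal_density 0 (sqrt (t - s)) x))"
    using W st unfolding standard_wiener_def by blast
  moreover have "0 < sqrt (t - s)" using st by simp
  moreover have "\<sigma> / sqrt (t - s) \<noteq> 0" using st \<sigma> by auto
  ultimately have "distributed M lborel (\<lambda>\<omega>. 0 + \<sigma> / sqrt (t - s) * (W t \<omega> - W s \<omega>))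
      (normal_density (0 + \<sigma> / sqrt (t - s) * 0) (\<bar>\<sigma> / sqrt (t - s)\<bar> * sqrt (t - s)))"
    by (rule normal_density_affine)
  moreover have "\<bar>\<sigma> / sqrt (t - s)\<bar> * sqrt (t - s) = 1"
    using st \<sigma> by simp
  ultimately show ?thesis by (simp only: mult_zero_right add_0_left)
qed

lemma (in prob_space) wiener_increment_tail:
  assumes W: "standard_wiener W" and st: "0 \<le> s" "s < t" "t \<le> 1" and x: "0 < x"
  shows "prob {\<omega> \<in> space M. \<not> (W t \<omega> - W s \<omega>)\<^sup>2 \<le> x\<^sup>2 * (t - s)}
    \<le> (fact (2 * j) / (2 ^ j * fact j)) / x ^ (2 * j)"
proof -
  let ?X = "\<lambda>\<omega>. 1 / sqrt (t - s) * (W t \<omega> - W s \<omega>)"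
  have "\<not> (W t \<omega> - W s \<omega>)\<^sup>2 \<le> x\<^sup>2 * (t - s) \<longleftrightarrow> x < \<bar>?X \<omega>\<bar>" for \<omega>
  proof -
    have "(W t \<omega> - W s \<omega>)\<^sup>2 \<le> x\<^sup>2 * (t - s) \<longleftrightarrow> (?X \<omega>)\<^sup>2 \<le> x\<^sup>2"
      using st by (simp add: power_mult_distrib power_divide pos_divide_le_eq)
    also have "\<dots> \<longleftrightarrow> \<bar>?X \<omega>\<bar> \<le> x" using x by (metis abs_le_square_iff abs_of_pos)
    finally show ?thesis by linarith
  qed
  then show ?thesis
    using std_normal_tail_bound[OF std_normal_signed_increment[OF W st, of 1] x, of j] by simp
qed

text \<open>Independence of whole processes and independence of the increments within each process
  combine to joint independence of all increments: a rectangle of conditions factorizes first over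
  the processes, then over the increments.\<close>

lemma (in prob_space) indep_vars_pairs:
  assumes I: "finite I" "I \<noteq> {}" and J: "finite J" "J \<noteq> {}"
    and outer: "indep_vars N Y I"
    and g: "\<And>i j. i \<in> I \<Longrightarrow> j \<in> J \<Longrightarrow> g i j \<in> measurable (N i) L"
    and inner: "\<And>i. i \<in> I \<Longrightarrow> indep_vars (\<lambda>_. L) (\<lambda>j \<omega>. g i j (Y i \<omega>)) J"
  shows "indep_vars (\<lambda>_. L) (\<lambda>p \<omega>. g (fst p) (snd p) (Y (fst p) \<omega>)) (I \<times> J)"
proof -
  let ?X = "\<lambda>p \<omega>. g (fst p) (snd p) (Y (fst p) \<omega>)"
  have Y: "Y i \<in> measurable M (N i)" if "i \<in> I" for i
    using outer that by (auto simp: indep_vars_def)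
  have X: "random_variable L (?X p)" if "p \<in> I \<times> J" for p
    using that Y g by (auto intro: measurable_compose)
  have "prob ((\<Inter>p\<in>I \<times> J. ?X p -` A p) \<inter> space M) = (\<Prod>p\<in>I \<times> J. prob (?X p -` A p \<inter> space M))"
    if A: "A \<in> (\<Pi> p\<in>I \<times> J. sets L)" for A
  proof -
    have A': "A (i, j) \<in> sets L" if "i \<in> I" "j \<in> J" for i j using A that by auto
    define B where "B i = space (N i) \<inter> (\<Inter>j\<in>J. g i j -` A (i, j) \<inter> space (N i))" for i
    have B: "B i \<in> sets (N i)" if "i \<in> I" for i
      unfolding B_def using J that g A' by (intro sets.Int sets.finite_INT measurable_sets) auto
    have BY: "Y i -` B i \<inter> space M = (\<Inter>j\<in>J. (\<lambda>\<omega>. g i j (Y i \<omega>)) -` A (i, j) \<inter> space M)" if "i \<in> I" for i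
      using measurable_space[OF Y[OF that]] J by (auto simp: B_def)
    have "(\<Inter>p\<in>I \<times> J. ?X p -` A p) \<inter> space M = (\<Inter>i\<in>I. Y i -` B i \<inter> space M)"
      using I J BY by auto
    then have "prob ((\<Inter>p\<in>I \<times> J. ?X p -` A p) \<inter> space M) = (\<Prod>i\<in>I. prob (Y i -` B i \<inter> space M))"
      using indep_varsD_finite[OF outer I(2,1) B] by simp
    also have "\<dots> = (\<Prod>i\<in>I. \<Prod>j\<in>J. prob ((\<lambda>\<omega>. g i j (Y i \<omega>)) -` A (i, j) \<inter> space M))"
      using BY indep_varsD_finite[OF inner J(2,1) A'] by (intro prod.cong) auto
    finally show ?thesis by (simp add: prod.cartesian_product case_prod_beta)
  qed
  then show ?thesis
    using I J X sets.space_closed[of L]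
    by (subst indep_vars_finite[where E = "\<lambda>_. sets L"])
      (auto simp: sets.sigma_sets_eq sets.Int_stable)
qed

text \<open>The columns are independent, and within a column the event that all entries exceed
  \<open>c\<close> has probability \<open>p ^ card I\<close>.\<close>

lemma (in prob_space) prob_no_column_exceeds:
  fixes X :: "'i \<times> 'j \<Rightarrow> 'a \<Rightarrow> real"
  assumes I: "finite I" "I \<noteq> {}" and J: "finite J" "J \<noteq> {}"
    and X: "indep_vars (\<lambda>_. borel) X (I \<times> J)"
    and p: "\<And>i j. i \<in> I \<Longrightarrow> j \<in> J \<Longrightarrow> prob {\<omega> \<in> space M. c \<le> X (i, j) \<omega>} = p"
  shows "prob {\<omega> \<in> space M. \<forall>j\<in>J. \<exists>i\<in>I. \<not> c \<le> X (i, j) \<omega>} = (1 - p ^ card I) ^ card J"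
proof -
  let ?P = "\<lambda>j. PiM (I \<times> {j}) (\<lambda>_. borel :: real measure)"
  let ?R = "\<lambda>j \<omega>. restrict (\<lambda>p. X p \<omega>) (I \<times> {j})"
  have R: "indep_vars ?P ?R J"
    using X by (rule indep_vars_restrict) (auto simp: disjoint_family_on_def)
  have rv: "random_variable borel (X (i, j))" if "i \<in> I" "j \<in> J" for i j
    using X that by (auto simp: indep_vars_def)
  define B :: "'j \<Rightarrow> ('i \<times> 'j \<Rightarrow> real) set" where "B j = {x \<in> space (?P j). \<exists>i\<in>I. \<not> c \<le> x (i, j)}" for j
  have B: "B j \<in> sets (?P j)" for j :: 'j
  proof -
    have "Measurable.pred (?P j) (\<lambda>x. \<not> c \<le> x (i, j))" if "i \<in> I" for i
    proof -
      have [measurable]: "(\<lambda>x. x (i, j)) \<in> borel_measurable (?P j)"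
        using that by (intro measurable_component_singleton) auto
      show ?thesis by measurable
    qed
    then show ?thesis unfolding B_def using I(1) by (intro sets.sets_Collect_finite_Ex) (auto simp: pred_def)
  qed
  have RB: "?R j -` B j \<inter> space M = {\<omega> \<in> space M. \<exists>i\<in>I. \<not> c \<le> X (i, j) \<omega>}" for j
    by (auto simp: B_def space_PiM)
  have "{\<omega> \<in> space M. \<forall>j\<in>J. \<exists>i\<in>I. \<not> c \<le> X (i, j) \<omega>} = (\<Inter>j\<in>J. ?R j -` B j \<inter> space M)"
    using J unfolding RB by auto
  then have "prob {\<omega> \<in> space M. \<forall>j\<in>J. \<exists>i\<in>I. \<not> c \<le> X (i, j) \<omega>} = (\<Prod>j\<in>J. prob (?R j -` B j \<inter> space M))"
    using indep_varsD_finite[OF R J(2,1) B] by simp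
  also have "\<dots> = (\<Prod>j\<in>J. 1 - p ^ card I)"
  proof (rule prod.cong)
    fix j assume j: "j \<in> J"
    have ev: "{\<omega> \<in> space M. c \<le> X (i, j) \<omega>} \<in> events" if "i \<in> I" for i
      using rv[OF that j] by measurable
    have "prob (\<Inter>p\<in>I \<times> {j}. X p -` {c..} \<inter> space M) = (\<Prod>p\<in>I \<times> {j}. prob (X p -` {c..} \<inter> space M))"
      using I j by (intro indep_varsD[OF X]) auto
    also have "\<dots> = (\<Prod>z\<in>I \<times> {j}. p)"
      using p j by (intro prod.cong) (auto simp: vimage_def Int_def conj_commute)
    also have "\<dots> = p ^ card I" by (simp add: card_cartesian_product)
    also have "(\<Inter>p\<in>I \<times> {j}. X p -` {c..} \<inter> space M) = (\<Inter>i\<in>I. {\<omega> \<in> space M. c \<le> X (i, j) \<omega>})"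
      by auto
    finally have *: "prob (\<Inter>i\<in>I. {\<omega> \<in> space M. c \<le> X (i, j) \<omega>}) = p ^ card I" .
    have "?R j -` B j \<inter> space M = space M - (\<Inter>i\<in>I. {\<omega> \<in> space M. c \<le> X (i, j) \<omega>})"
      using I unfolding RB by auto
    then show "prob (?R j -` B j \<inter> space M) = 1 - p ^ card I"
      using * I ev by (simp add: prob_compl sets.finite_INT)
  qed simp
  finally show ?thesis by simp
qed

lemma (in prob_space) prob_UN_le:
  assumes "finite I" "\<And>i. i \<in> I \<Longrightarrow> E i \<in> events" "\<And>i. i \<in> I \<Longrightarrow> prob (E i) \<le> c"
  shows "prob (\<Union>i\<in>I. E i) \<le> real (card I) * c"
proof -
  have "prob (\<Union>i\<in>I. E i) \<le> (\<Sum>i\<in>I. prob (E i))"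
    using assms by (intro finite_measure_subadditive_finite) auto
  also have "\<dots> \<le> real (card I) * c"
    using assms by (intro sum_bounded_above) auto
  finally show ?thesis .
qed

text \<open>The inequality \<open>(1 + x / k) ^ k \<le> exp x\<close> turns geometric decay into
  polynomial decay of any order, with an explicit constant.\<close>

lemma power_decay:
  fixes a :: real
  assumes a: "0 < a" "a \<le> 1" and q: "0 < q" and k: "0 < k"
  shows "(1 - a) ^ (q - 1) \<le> (real k / a) ^ k / real q ^ k"
proof -
  have k1: "1 \<le> real k" using k by simp
  have q1: "real (q - 1) = real q - 1" using q by simp
  have "a * real q / real k \<le> 1 + a * real (q - 1) / real k"
  proof -
    have "a * real q \<le> real k + a * real (q - 1)"
      using a k1 unfolding q1 right_diff_distrib by linarith
    then have "a * real q / real k \<le> (real k + a * real (q - 1)) / real k"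
      by (rule divide_right_mono) simp
    then show ?thesis using k by (simp add: add_divide_distrib)
  qed
  then have "(a * real q / real k) ^ k \<le> (1 + a * real (q - 1) / real k) ^ k"
    using a by (intro power_mono) auto
  also have "\<dots> \<le> exp (a * real (q - 1))"
  proof -
    have "0 \<le> a * real (q - 1)" using a by simp
    then have "- real k \<le> a * real (q - 1)" using k1 by linarith
    then show ?thesis using k by (intro exp_ge_one_plus_x_over_n_power_n) auto
  qed
  finally have lower: "(a * real q / real k) ^ k \<le> exp (a * real (q - 1))" .
  have pos: "0 < (a * real q / real k) ^ k" using a q k by simp
  have "(1 - a) ^ (q - 1) \<le> exp (- a) ^ (q - 1)"
    using a exp_ge_add_one_self[of "- a"] by (intro power_mono) auto
  also have "\<dots> = exp (real (q - 1) * - a)"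
    by (rule exp_of_nat_mult[symmetric])
  also have "\<dots> = 1 / exp (a * real (q - 1))"
    by (simp add: exp_minus divide_inverse mult.commute)
  also have "\<dots> \<le> 1 / (a * real q / real k) ^ k"
    using lower pos by (intro divide_left_mono) auto
  also have "\<dots> = (real k / a) ^ k / real q ^ k"
    by (simp add: power_divide power_mult_distrib)
  finally show ?thesis .
qed

lemma power_quotient_le:
  fixes x :: real
  assumes "1 \<le> x" "a + p \<le> b"
  shows "x ^ a / x ^ b \<le> 1 / x ^ p"
proof -
  have "x ^ a * x ^ p \<le> x ^ b"
    unfolding power_add[symmetric] using assms(2,1) by (rule power_increasing)
  then have "x ^ a / x ^ b \<le> x ^ a / (x ^ a * x ^ p)"
    using assms by (intro divide_left_mono) auto
  then show ?thesis using assms by simp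
qed

section \<open>Irregular paths have superpolynomially small probability\<close>

definition irregular_event :: "'a measure \<Rightarrow> nat \<Rightarrow> (nat \<Rightarrow> real \<Rightarrow> 'a \<Rightarrow> real) \<Rightarrow> nat \<Rightarrow> nat \<Rightarrow> 'a set" where
  "irregular_event M d W q f = {\<omega> \<in> space M. \<not> regular_path d q f (\<lambda>k t. W k t \<omega>)}"

context prob_space
begin

lemma prob_no_signed_increment:
  assumes W: "iid_standard_wiener d W" and q: "2 \<le> q" and f: "0 < f"
    and l: "l < q ^ (2 * f - 1)"
  shows "prob {\<omega> \<in> space M. \<forall>i<q - 1. \<exists>k\<in>{1..d}. \<not> 1 / real q ^ f \<le> (if k \<in> S then 1 else -1) *
         (W k (grid_point q (2 * f) (l * q + Suc i)) \<omega> - W k (grid_point q (2 * f) (l * q + i)) \<omega>)}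
    = (1 - normal_tail ^ d) ^ (q - 1)" (is "prob ?E = _")
proof (cases "d = 0")
  case True
  then have "?E = {}" using q by (auto intro!: exI[of _ 0])
  then have "prob ?E = 0" by (simp only: measure_empty)
  also have "\<dots> = (1 - normal_tail ^ d) ^ (q - 1)" using True q by (simp add: zero_power)
  finally show ?thesis .
next
  case False
  let ?\<tau> = "\<lambda>i. grid_point q (2 * f) (l * q + i)"
  let ?\<sigma> = "\<lambda>k. (if k \<in> S then 1 else -1 :: real)"
  let ?g = "\<lambda>k i y. ?\<sigma> k * real q ^ f * (y (?\<tau> (Suc i)) - y (?\<tau> i))"
  let ?Y = "\<lambda>k \<omega>. \<lambda>t\<in>{0..1}. W k t \<omega>"
  let ?X = "\<lambda>z \<omega>. ?g (fst z) (snd z) (?Y (fst z) \<omega>)"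
  have wiener: "standard_wiener (W k)" if "k \<in> {1..d}" for k
    using W that by (auto simp: iid_standard_wiener_def)
  have q0: "0 < real q" using q by simp
  have \<tau>01: "?\<tau> i \<in> {0..1}" if "i \<le> q - 1" for i
    using that q f l by (intro grid_point_in_unit block_index_less) auto
  have \<tau>Suc: "?\<tau> (Suc i) = ?\<tau> i + 1 / real q ^ (2 * f)" for i
    by (simp add: grid_point_def add_divide_distrib)
  have \<tau>mono: "?\<tau> i < ?\<tau> (Suc i)" for i
    unfolding \<tau>Suc using q0 by simp
  have \<tau>step: "?\<tau> (Suc i) - ?\<tau> i = (1 / real q ^ f)\<^sup>2" for i
    unfolding \<tau>Suc by (simp add: power_divide mult.commute flip: power_mult)
  have sqrt: "1 / sqrt (?\<tau> (Suc i) - ?\<tau> i) = real q ^ f" for i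
    using q0 unfolding \<tau>step by simp
  have gY: "?g k i (?Y k \<omega>) = ?\<sigma> k * real q ^ f * (W k (?\<tau> (Suc i)) \<omega> - W k (?\<tau> i) \<omega>)" if "i < q - 1" for k i \<omega>
    using \<tau>01[of i] \<tau>01[of "Suc i"] that by simp
  have indep: "indep_vars (\<lambda>_. borel) ?X ({1..d} \<times> {..<q - 1})"
  proof (rule indep_vars_pairs[where g = ?g and Y = ?Y and N = "\<lambda>_. PiM {0..1} (\<lambda>_. borel)"])
    show "indep_vars (\<lambda>_. PiM {0..1} (\<lambda>_. borel)) ?Y {1..d}"
      using W by (auto simp: iid_standard_wiener_def)
    show "?g k i \<in> borel_measurable (PiM {0..1} (\<lambda>_. borel))" if "i \<in> {..<q - 1}" for k i
    proof -
      have [measurable]: "(\<lambda>y. y (?\<tau> i)) \<in> borel_measurable (PiM {0..1} (\<lambda>_. borel))"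
        "(\<lambda>y. y (?\<tau> (Suc i))) \<in> borel_measurable (PiM {0..1} (\<lambda>_. borel))"
        using that \<tau>01[of i] \<tau>01[of "Suc i"] by (auto intro!: measurable_component_singleton)
      show ?thesis by measurable
    qed
    show "indep_vars (\<lambda>_. borel) (\<lambda>i \<omega>. ?g k i (?Y k \<omega>)) {..<q - 1}" if k: "k \<in> {1..d}" for k
    proof -
      have "\<forall>(n::nat) t. (\<forall>i\<le>n. t i \<in> {0..1}) \<and> (\<forall>i<n. t i < t (Suc i)) \<longrightarrow>
          indep_vars (\<lambda>_. borel) (\<lambda>i \<omega>. W k (t (Suc i)) \<omega> - W k (t i) \<omega>) {..<n}"
        using wiener[OF k] unfolding standard_wiener_def by blast
      from this[rule_format, of "q - 1" ?\<tau>]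
      have "indep_vars (\<lambda>_. borel) (\<lambda>i \<omega>. W k (?\<tau> (Suc i)) \<omega> - W k (?\<tau> i) \<omega>) {..<q - 1}"
        using \<tau>01 \<tau>mono by blast
      then have "indep_vars (\<lambda>_. borel) (\<lambda>i \<omega>. ?\<sigma> k * real q ^ f * (W k (?\<tau> (Suc i)) \<omega> - W k (?\<tau> i) \<omega>)) {..<q - 1}"
        by (rule indep_vars_compose2[where Y = "\<lambda>_ x. ?\<sigma> k * real q ^ f * x"]) measurable
      then show ?thesis
      proof (rule indep_vars_cong[OF refl _ refl, THEN iffD1, rotated])
        fix i assume "i \<in> {..<q - 1}"
        then have "i < q - 1" by simp
        from gY[OF this, of k]
        show "(\<lambda>\<omega>. ?\<sigma> k * real q ^ f * (W k (?\<tau> (Suc i)) \<omega> - W k (?\<tau> i) \<omega>)) = (\<lambda>\<omega>. ?g k i (?Y k \<omega>))"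
          by (intro ext) (rule sym)
      qed
    qed
  qed (use False q in \<open>auto simp: lessThan_empty_iff\<close>)
  have p: "prob {\<omega> \<in> space M. 1 \<le> ?X (k, i) \<omega>} = normal_tail" if "k \<in> {1..d}" "i \<in> {..<q - 1}" for k i
  proof -
    have "distributed M lborel (\<lambda>\<omega>. ?\<sigma> k / sqrt (?\<tau> (Suc i) - ?\<tau> i) * (W k (?\<tau> (Suc i)) \<omega> - W k (?\<tau> i) \<omega>)) std_normal_density"
      using that \<tau>01[of i] \<tau>01[of "Suc i"] \<tau>mono by (intro std_normal_signed_increment wiener) auto
    then have "distributed M lborel (\<lambda>\<omega>. ?\<sigma> k * real q ^ f * (W k (?\<tau> (Suc i)) \<omega> - W k (?\<tau> i) \<omega>)) std_normal_density"
      unfolding divide_inverse[of "?\<sigma> k"] inverse_eq_divide sqrt .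
    from prob_std_normal_ge_one[OF this] show ?thesis
      using gY[of i k] that by (simp only: fst_conv snd_conv lessThan_iff)
  qed
  have iff: "1 / real q ^ f \<le> ?\<sigma> k * (W k (?\<tau> (Suc i)) \<omega> - W k (?\<tau> i) \<omega>) \<longleftrightarrow> 1 \<le> ?X (k, i) \<omega>" if "i < q - 1" for k i \<omega>
    unfolding fst_conv snd_conv gY[OF that] using q0 by (simp add: pos_divide_le_eq mult_ac)
  have "{\<omega> \<in> space M. \<forall>i<q - 1. \<exists>k\<in>{1..d}. \<not> 1 / real q ^ f \<le> ?\<sigma> k * (W k (?\<tau> (Suc i)) \<omega> - W k (?\<tau> i) \<omega>)}
      = {\<omega> \<in> space M. \<forall>i\<in>{..<q - 1}. \<exists>k\<in>{1..d}. \<not> 1 \<le> ?X (k, i) \<omega>}"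
    using iff by (intro Collect_cong conj_cong refl) (simp only: lessThan_iff Ball_def, blast)
  also have "prob \<dots> = (1 - normal_tail ^ card {1..d}) ^ card {..<q - 1}"
    using False q by (intro prob_no_column_exceeds indep p) (auto simp: lessThan_empty_iff)
  finally show ?thesis by simp
qed

text \<open>A union bound over the pairs of grid points for the size of the increments and over
  the sign patterns and blocks for the signs. The free parameter \<open>j\<close> is half the
  order of the moment in the tail bound.\<close>

lemma irregular_event_bound:
  assumes W: "iid_standard_wiener d W" and q: "2 \<le> q" and f: "0 < f"
  shows "irregular_event M d W q f \<in> events"
    and "prob (irregular_event M d W q f) \<le>
      real (d * (q ^ (2 * f) * q ^ (2 * f))) * ((fact (2 * j) / (2 ^ j * fact j)) / real q ^ (2 * j))
      + real (2 ^ d * q ^ (2 * f - 1)) * (1 - normal_tail ^ d) ^ (q - 1)"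
proof -
  let ?g = "grid_point q (2 * f)" and ?n = "q ^ (2 * f)"
  let ?\<sigma> = "\<lambda>S k. (if k \<in> S then 1 else -1 :: real)"
  have wiener: "standard_wiener (W k)" if "k \<in> {1..d}" for k
    using W that by (auto simp: iid_standard_wiener_def)
  have rv: "random_variable borel (W k t)" if "k \<in> {1..d}" "t \<in> {0..1}" for k t
    using wiener[OF that(1)] that(2) by (auto simp: standard_wiener_def)
  have rvg: "random_variable borel (W k (?g i))" if "k \<in> {1..d}" "i < ?n" for k i
    using rv[OF that(1)] grid_point_in_unit[OF that(2)] .
  define E0 where "E0 k = {\<omega> \<in> space M. W k 0 \<omega> \<noteq> 0}" for k
  define E1 where "E1 = (\<lambda>(k, j, i). {\<omega> \<in> space M. i < j \<and>
      \<not> (W k (?g j) \<omega> - W k (?g i) \<omega>)\<^sup>2 \<le> (real q)\<^sup>2 * (?g j - ?g i)})"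
  define E2 where "E2 = (\<lambda>(S, l). {\<omega> \<in> space M. \<forall>i<q - 1. \<exists>k\<in>{1..d}. \<not> 1 / real q ^ f \<le> ?\<sigma> S k *
         (W k (?g (l * q + Suc i)) \<omega> - W k (?g (l * q + i)) \<omega>)})"
  let ?I1 = "{1..d} \<times> ({..<?n} \<times> {..<?n})" and ?I2 = "Pow {1..d} \<times> {..<q ^ (2 * f - 1)}"
  have decomp: "irregular_event M d W q f = (\<Union>k\<in>{1..d}. E0 k) \<union> (\<Union>z\<in>?I1. E1 z) \<union> (\<Union>z\<in>?I2. E2 z)"
  proof (rule set_eqI)
    fix \<omega>
    define P where "P k j i \<longleftrightarrow> (W k (?g j) \<omega> - W k (?g i) \<omega>)\<^sup>2 \<le> (real q)\<^sup>2 * (?g j - ?g i)" for k j i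
    define R where "R S l i k \<longleftrightarrow> 1 / real q ^ f \<le> ?\<sigma> S k *
         (W k (?g (l * q + Suc i)) \<omega> - W k (?g (l * q + i)) \<omega>)" for S l i k
    have E1_iff: "\<omega> \<in> E1 (k, j, i) \<longleftrightarrow> \<omega> \<in> space M \<and> i < j \<and> \<not> P k j i" for k j i
      unfolding E1_def P_def by simp
    have "\<omega> \<in> (\<Union>z\<in>?I1. E1 z) \<longleftrightarrow>
        \<omega> \<in> space M \<and> (\<exists>k\<in>{1..d}. \<exists>j<?n. \<exists>i<?n. i < j \<and> \<not> P k j i)"
      unfolding UN_iff split_paired_Bex_Sigma E1_iff by blast
    then have E1: "\<omega> \<in> (\<Union>z\<in>?I1. E1 z) \<longleftrightarrow> \<omega> \<in> space M \<and> \<not> (\<forall>k\<in>{1..d}. \<forall>j<?n. \<forall>i<j. P k j i)"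
      using less_trans[of _ _ ?n] by meson
    have E2_iff: "\<omega> \<in> E2 (S, l) \<longleftrightarrow> \<omega> \<in> space M \<and> (\<forall>i<q - 1. \<exists>k\<in>{1..d}. \<not> R S l i k)" for S l
      unfolding E2_def R_def by simp
    have E2: "\<omega> \<in> (\<Union>z\<in>?I2. E2 z) \<longleftrightarrow> \<omega> \<in> space M \<and>
        \<not> (\<forall>S\<in>Pow {1..d}. \<forall>l<q ^ (2 * f - 1). \<exists>i<q - 1. \<forall>k\<in>{1..d}. R S l i k)"
      unfolding UN_iff split_paired_Bex_Sigma E2_iff by blast
    have "\<omega> \<in> irregular_event M d W q f \<longleftrightarrow> \<omega> \<in> space M \<and>
        \<not> ((\<forall>k\<in>{1..d}. W k 0 \<omega> = 0) \<and> (\<forall>k\<in>{1..d}. \<forall>j<?n. \<forall>i<j. P k j i) \<and>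
           (\<forall>S\<in>Pow {1..d}. \<forall>l<q ^ (2 * f - 1). \<exists>i<q - 1. \<forall>k\<in>{1..d}. R S l i k))"
      unfolding irregular_event_def regular_path_def P_def R_def by simp
    moreover have "\<omega> \<in> (\<Union>k\<in>{1..d}. E0 k) \<longleftrightarrow> \<omega> \<in> space M \<and> \<not> (\<forall>k\<in>{1..d}. W k 0 \<omega> = 0)"
      unfolding E0_def by blast
    ultimately show "\<omega> \<in> irregular_event M d W q f \<longleftrightarrow> \<omega> \<in> (\<Union>k\<in>{1..d}. E0 k) \<union> (\<Union>z\<in>?I1. E1 z) \<union> (\<Union>z\<in>?I2. E2 z)"
      unfolding Un_iff using E1 E2 by argo
  qed
  have E0: "E0 k \<in> events" if "k \<in> {1..d}" for k
    unfolding E0_def using rv[OF that, of 0] by measurable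
  have E1: "E1 z \<in> events" if zI: "z \<in> ?I1" for z
  proof -
    obtain k j i where z: "z = (k, j, i)" "k \<in> {1..d}" "j < ?n" "i < ?n" using zI by auto
    have [measurable]: "random_variable borel (W k (?g j))" "random_variable borel (W k (?g i))"
      using rvg z by auto
    show ?thesis unfolding E1_def z prod.case by measurable
  qed
  have E2: "E2 z \<in> events" if zI: "z \<in> ?I2" for z
  proof -
    obtain S l where z: "z = (S, l)" "l < q ^ (2 * f - 1)" using zI by auto
    have meas: "random_variable borel (W k (?g (l * q + i)))" if "k \<in> {1..d}" "i < q" for k i
      using rvg[OF that(1)] block_index_less[OF z(2) that(2)] f by simp
    have ev: "{\<omega> \<in> space M. \<not> 1 / real q ^ f \<le> ?\<sigma> S k *
         (W k (?g (l * q + Suc i)) \<omega> - W k (?g (l * q + i)) \<omega>)} \<in> events"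
      if "k \<in> {1..d}" "i \<in> {..<q - 1}" for k i
    proof -
      have inc: "(\<lambda>\<omega>. ?\<sigma> S k * (W k (?g (l * q + Suc i)) \<omega> - W k (?g (l * q + i)) \<omega>)) \<in> borel_measurable M"
        using meas[of k i] meas[of k "Suc i"] that
        by (intro borel_measurable_times borel_measurable_diff borel_measurable_const) auto
      show ?thesis
        unfolding not_le by (rule borel_measurable_less[OF inc borel_measurable_const])
    qed
    have "{\<omega> \<in> space M. \<forall>i\<in>{..<q - 1}. \<exists>k\<in>{1..d}. \<not> 1 / real q ^ f \<le> ?\<sigma> S k *
         (W k (?g (l * q + Suc i)) \<omega> - W k (?g (l * q + i)) \<omega>)} \<in> events"
      by (intro sets.sets_Collect_finite_All sets.sets_Collect_finite_Ex ev finite_lessThan finite_atLeastAtMost)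
    then show ?thesis unfolding E2_def z prod.case by (simp only: Ball_def lessThan_iff)
  qed
  have U0: "(\<Union>k\<in>{1..d}. E0 k) \<in> events" using E0 by (intro sets.finite_UN) auto
  have U1: "(\<Union>z\<in>?I1. E1 z) \<in> events" using E1 by (intro sets.finite_UN) auto
  have U2: "(\<Union>z\<in>?I2. E2 z) \<in> events" using E2 by (intro sets.finite_UN) auto
  show "irregular_event M d W q f \<in> events" unfolding decomp using U0 U1 U2 by auto
  let ?C = "(fact (2 * j) / (2 ^ j * fact j)) / real q ^ (2 * j) :: real"
  have "prob (\<Union>k\<in>{1..d}. E0 k) \<le> real (card {1..d}) * 0"
  proof (rule prob_UN_le)
    fix k assume k: "k \<in> {1..d}"
    then have "AE \<omega> in M. W k 0 \<omega> = 0" using wiener by (auto simp: standard_wiener_def)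
    then have "AE \<omega> in M. \<omega> \<notin> E0 k" by eventually_elim (simp add: E0_def)
    then show "prob (E0 k) \<le> 0" using prob_eq_0[OF E0[OF k]] by simp
  qed (use E0 in auto)
  moreover have "prob (\<Union>z\<in>?I1. E1 z) \<le> real (card ?I1) * ?C"
  proof (rule prob_UN_le)
    fix z assume "z \<in> ?I1"
    then obtain k j' i where z: "z = (k, j', i)" "k \<in> {1..d}" "j' < ?n" "i < ?n" by auto
    show "prob (E1 z) \<le> ?C"
    proof (cases "i < j'")
      case True
      then have "?g i < ?g j'" using q by (simp add: grid_point_def divide_strict_right_mono)
      moreover have "E1 z = {\<omega> \<in> space M. \<not> (W k (?g j') \<omega> - W k (?g i) \<omega>)\<^sup>2 \<le> (real q)\<^sup>2 * (?g j' - ?g i)}"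
        using True by (simp add: E1_def z)
      ultimately show ?thesis
        using wiener_increment_tail[OF wiener[OF z(2)], of "?g i" "?g j'" "real q" j]
          grid_point_in_unit[OF z(3)] grid_point_in_unit[OF z(4)] q by simp
    qed (simp add: E1_def z)
  qed (use E1 in auto)
  moreover have "prob (\<Union>z\<in>?I2. E2 z) \<le> real (card ?I2) * (1 - normal_tail ^ d) ^ (q - 1)"
  proof (rule prob_UN_le)
    fix z assume "z \<in> ?I2"
    then obtain S l where z: "z = (S, l)" "l < q ^ (2 * f - 1)" by auto
    show "prob (E2 z) \<le> (1 - normal_tail ^ d) ^ (q - 1)"
      using prob_no_signed_increment[OF W q f z(2), of S] by (simp add: E2_def z)
  qed (use E2 in auto)
  moreover have "prob (irregular_event M d W q f) \<le>
      prob (\<Union>k\<in>{1..d}. E0 k) + prob (\<Union>z\<in>?I1. E1 z) + prob (\<Union>z\<in>?I2. E2 z)"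
    unfolding decomp
    using measure_Un_le[OF sets.Un[OF U0 U1] U2] measure_Un_le[OF U0 U1] by linarith
  ultimately show "prob (irregular_event M d W q f) \<le>
      real (d * (q ^ (2 * f) * q ^ (2 * f))) * ?C + real (2 ^ d * q ^ (2 * f - 1)) * (1 - normal_tail ^ d) ^ (q - 1)"
    by (simp add: card_cartesian_product card_Pow)
qed

text \<open>The grid has polynomial size in \<open>q\<close>; a moment of high enough order and
  the geometric decay beat it.\<close>

lemma irregular_event_superpolynomial:
  assumes W: "iid_standard_wiener d W" and f: "0 < f"
  shows "\<exists>C. \<forall>q\<ge>2. prob (irregular_event M d W q f) \<le> C / real q ^ p"
proof -
  define k where "k = 2 * f + p"
  define a where "a = normal_tail ^ d"
  define c where "c = (fact (2 * k) / (2 ^ k * fact k) :: real)"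
  have a: "0 < a" "a \<le> 1"
    using normal_tail_pos normal_tail_le_1 by (auto simp: a_def power_le_one)
  have c: "0 \<le> c" by (simp add: c_def)
  have "prob (irregular_event M d W q f) \<le> (real d * c + 2 ^ d * (real k / a) ^ k) / real q ^ p" if q: "2 \<le> q" for q
  proof -
    have q0: "0 < real q" and q1: "1 \<le> real q" using q by auto
    have "prob (irregular_event M d W q f) \<le>
      real (d * (q ^ (2 * f) * q ^ (2 * f))) * (c / real q ^ (2 * k)) + real (2 ^ d * q ^ (2 * f - 1)) * (1 - a) ^ (q - 1)"
      using irregular_event_bound(2)[OF W q f, of k] unfolding a_def c_def .
    also have "real (d * (q ^ (2 * f) * q ^ (2 * f))) * (c / real q ^ (2 * k)) \<le> real d * c / real q ^ p"
    proof -
      have "real q ^ (2 * f) * real q ^ (2 * f) / real q ^ (2 * k) \<le> 1 / real q ^ p"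
        unfolding power_add[symmetric] by (rule power_quotient_le[OF q1]) (simp add: k_def)
      then have "real d * c * (real q ^ (2 * f) * real q ^ (2 * f) / real q ^ (2 * k)) \<le> real d * c * (1 / real q ^ p)"
        using c by (intro mult_left_mono) auto
      then show ?thesis by (simp add: mult_ac)
    qed
    also have "real (2 ^ d * q ^ (2 * f - 1)) * (1 - a) ^ (q - 1)
        \<le> real (2 ^ d * q ^ (2 * f - 1)) * ((real k / a) ^ k / real q ^ k)"
      using a q f by (intro mult_left_mono power_decay) (auto simp: k_def)
    also have "\<dots> \<le> 2 ^ d * (real k / a) ^ k / real q ^ p"
    proof -
      have "real q ^ (2 * f - 1) / real q ^ k \<le> 1 / real q ^ p"
        by (rule power_quotient_le[OF q1]) (simp add: k_def)
      then have "2 ^ d * (real k / a) ^ k * (real q ^ (2 * f - 1) / real q ^ k) \<le> 2 ^ d * (real k / a) ^ k * (1 / real q ^ p)"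
        using a by (intro mult_left_mono) auto
      then show ?thesis by (simp add: mult_ac)
    qed
    finally show ?thesis by (simp add: add_divide_distrib)
  qed
  then show ?thesis by blast
qed

text \<open>If \<open>q\<close> is the integer part of a negative power of
  \<open>\<epsilon>\<close>, decay faster than any power of \<open>1 / q\<close> is decay faster
  than any power of \<open>\<epsilon>\<close>. The values of \<open>\<epsilon>\<close> with
  \<open>q < q0\<close> are bounded away from zero, so there the probability one is covered by the
  constant.\<close>

lemma negligible_events_floor_powr:
  assumes \<kappa>: "0 < \<kappa>" and q0: "0 < q0"
    and B: "\<And>q. q0 \<le> q \<Longrightarrow> B q \<in> events"
    and decay: "\<And>p::nat. \<exists>C. \<forall>q\<ge>q0. prob (B q) \<le> C / real q ^ p"
  shows "negligible_events (\<lambda>\<epsilon>. if q0 \<le> nat \<lfloor>\<epsilon> powr - \<kappa>\<rfloor> then B (nat \<lfloor>\<epsilon> powr - \<kappa>\<rfloor>) else space M)"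
  unfolding negligible_events_def
proof (intro conjI ballI allI impI)
  let ?H = "\<lambda>\<epsilon>. if q0 \<le> nat \<lfloor>\<epsilon> powr - \<kappa>\<rfloor> then B (nat \<lfloor>\<epsilon> powr - \<kappa>\<rfloor>) else space M"
  show "?H \<epsilon> \<in> events" for \<epsilon> using B by auto
  fix p :: real assume p: "1 \<le> p"
  define P where "P = nat \<lceil>p / \<kappa>\<rceil>"
  have P: "p / \<kappa> \<le> real P" by (simp add: P_def real_nat_ceiling_ge)
  obtain C where C: "\<And>q. q0 \<le> q \<Longrightarrow> prob (B q) \<le> C / real q ^ P" using decay[of P] by blast
  let ?C = "\<bar>C\<bar> * 2 ^ P + real q0 ^ P"
  show "\<exists>C. \<forall>\<epsilon>\<in>{0<..1}. prob (?H \<epsilon>) \<le> C * \<epsilon> powr p"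
  proof (intro exI ballI)
    fix \<epsilon> :: real assume \<epsilon>: "\<epsilon> \<in> {0<..1}"
    define y where "y = \<epsilon> powr - \<kappa>"
    define q where "q = nat \<lfloor>y\<rfloor>"
    have y1: "1 \<le> y" using \<epsilon> \<kappa> powr_mono'[of "- \<kappa>" 0 \<epsilon>] by (simp add: y_def)
    have qy: "real q \<le> y" "y < real q + 1" "1 \<le> q" using y1 by (auto simp: q_def le_nat_floor)
    have "y ^ P = \<epsilon> powr - (\<kappa> * real P)"
      using \<epsilon> by (simp add: y_def powr_realpow[symmetric] powr_powr)
    then have "1 / y ^ P = \<epsilon> powr (\<kappa> * real P)"
      by (simp add: powr_minus_divide)
    also have "\<dots> \<le> \<epsilon> powr p"
      using \<epsilon> P \<kappa> by (intro powr_mono') (auto simp: field_simps)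
    finally have yP: "1 / y ^ P \<le> \<epsilon> powr p" .
    have "prob (?H \<epsilon>) \<le> ?C * (1 / y ^ P)"
    proof (cases "q0 \<le> q")
      case True
      have "prob (?H \<epsilon>) \<le> C / real q ^ P" using C[OF True] True by (simp add: q_def y_def)
      also have "\<dots> \<le> \<bar>C\<bar> / real q ^ P" by (intro divide_right_mono) auto
      also have "\<dots> \<le> \<bar>C\<bar> / (y / 2) ^ P"
      proof (intro divide_left_mono power_mono)
        have "1 \<le> real q" using qy(3) by simp
        then show "y / 2 \<le> real q" using qy(2) by linarith
      qed (use y1 qy(3) in auto)
      also have "\<dots> = \<bar>C\<bar> * 2 ^ P * (1 / y ^ P)" by (simp add: power_divide)
      also have "\<dots> \<le> ?C * (1 / y ^ P)" using y1 by (intro mult_right_mono) auto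
      finally show ?thesis .
    next
      case False
      then have "y \<le> real q0" using qy by linarith
      then have "y ^ P \<le> real q0 ^ P" using y1 by (intro power_mono) auto
      also have "\<dots> \<le> ?C" by simp
      finally have "1 \<le> ?C * (1 / y ^ P)" using y1 by simp
      then show ?thesis using prob_le_1 order_trans by blast
    qed
    also have "\<dots> \<le> ?C * \<epsilon> powr p" using yP by (intro mult_left_mono) auto
    finally show "prob (?H \<epsilon>) \<le> ?C * \<epsilon> powr p" .
  qed
qed

end

section \<open>Small Wiener polynomials have small coefficients\<close>

lemma wiener_polynomial_eq_poly_at:
  assumes "\<And>\<alpha>. \<alpha> \<in> multi_indices d \<Longrightarrow> m < size \<alpha> \<Longrightarrow> A \<alpha> t \<omega> = 0"
  shows "wiener_polynomial d W A t \<omega> = poly_at d m (\<lambda>\<alpha>. A \<alpha> t \<omega>) (\<lambda>k. W k t \<omega>)"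
proof -
  have "wiener_polynomial d W A t \<omega> =
      (\<Sum>\<^sub>\<infinity>\<alpha>\<in>multi_indices_upto d m. A \<alpha> t \<omega> * wiener_monomial W \<alpha> t \<omega>)"
    unfolding wiener_polynomial_def
    by (rule infsum_cong_neutral) (use assms in \<open>auto simp: multi_indices_upto_def\<close>)
  then show ?thesis
    by (simp add: poly_at_def wiener_monomial_def monomial_at_def)
qed

lemma sup_norm_le_ennreal_iff:
  assumes "0 \<le> c"
  shows "sup_norm f \<le> ennreal c \<longleftrightarrow> (\<forall>t\<in>{0..1}. \<bar>f t\<bar> \<le> c)"
  using assms by (simp add: sup_norm_def SUP_le_iff)

lemma lip_norm_less_ennrealD:
  assumes "lip_norm f < ennreal c"
  shows "t \<in> {0..1} \<Longrightarrow> \<bar>f t\<bar> \<le> c"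
    and "s \<in> {0..1} \<Longrightarrow> t \<in> {0..1} \<Longrightarrow> \<bar>f t - f s\<bar> \<le> c * \<bar>t - s\<bar>"
proof -
  have c: "0 \<le> c" using assms by (metis ennreal_neg linear not_less_zero)
  have "sup_norm f \<le> lip_norm f" by (simp add: lip_norm_def)
  then have "sup_norm f \<le> ennreal c" using assms by simp
  then show "t \<in> {0..1} \<Longrightarrow> \<bar>f t\<bar> \<le> c" using sup_norm_le_ennreal_iff[OF c] by blast
  have "(INF L\<in>{L. L-lipschitz_on {0..1} f}. ennreal L) \<le> lip_norm f" by (simp add: lip_norm_def)
  then have "(INF L\<in>{L. L-lipschitz_on {0..1} f}. ennreal L) < ennreal c"
    using assms by (rule le_less_trans)
  then obtain L where L: "L-lipschitz_on {0..1} f" "ennreal L < ennreal c"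
    unfolding INF_less_iff by blast
  then have "L \<le> c" using c by (simp add: ennreal_less_iff lipschitz_on_nonneg[OF L(1)])
  assume "s \<in> {0..1}" "t \<in> {0..1}"
  then have "\<bar>f t - f s\<bar> \<le> L * \<bar>t - s\<bar>"
    using lipschitz_onD[OF L(1), of t s] by (simp add: dist_real_def)
  also have "\<dots> \<le> c * \<bar>t - s\<bar>" using \<open>L \<le> c\<close> by (rule mult_right_mono) simp
  finally show "\<bar>f t - f s\<bar> \<le> c * \<bar>t - s\<bar>" .
qed

theorem theorem7p1:
  fixes M :: "'a measure" and d m :: nat and W :: "nat \<Rightarrow> real \<Rightarrow> 'a \<Rightarrow> real"
  assumes "prob_space M"
    and "prob_space.iid_standard_wiener M d W"
  shows "\<exists>Osc :: real \<Rightarrow> 'a set. prob_space.negligible_events M Osc \<and>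
    (\<forall>A :: nat multiset \<Rightarrow> real \<Rightarrow> 'a \<Rightarrow> real.
      (\<forall>\<alpha>\<in>multi_indices d. \<forall>t\<in>{0..1}. A \<alpha> t \<in> borel_measurable M) \<and>
      (\<forall>\<alpha>\<in>multi_indices d. size \<alpha> > m \<longrightarrow> (\<forall>t\<in>{0..1}. \<forall>\<omega>\<in>space M. A \<alpha> t \<omega> = 0)) \<longrightarrow>
      (\<forall>\<epsilon>\<in>{0<..1}. \<forall>\<omega>\<in>space M - Osc \<epsilon>.
        sup_norm (\<lambda>t. wiener_polynomial d W A t \<omega>) \<le> ennreal \<epsilon> \<longrightarrow>
          (SUP \<alpha>\<in>multi_indices d. sup_norm (\<lambda>t. A \<alpha> t \<omega>)) \<le> ennreal (\<epsilon> powr (1 / 3 ^ m)) \<or>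
          (SUP \<alpha>\<in>multi_indices d. lip_norm (\<lambda>t. A \<alpha> t \<omega>)) \<ge> ennreal (\<epsilon> powr (- (1 / 3 ^ (m + 1))))))"
proof -
  interpret prob_space M by fact
  have W: "iid_standard_wiener d W" by fact
  \<comment> \<open>\<open>Q\<close> makes both thresholds integral powers of \<open>\<epsilon>\<close> to the power \<open>- (1 / Q)\<close>; \<open>q0\<close> dominates all constants\<close>
  define Q where "Q = 2 * slack m * 3 ^ (m + 1)"
  define \<kappa> where "\<kappa> = 1 / real Q"
  define q0 where "q0 = max (card (multi_indices_upto d m)) (max m (2 ^ (6 * slack m)))"
  define B where "B q = (\<Union>n\<in>{..m}. irregular_event M d W q (mesh_exponent m n))" for q
  define idx where "idx \<epsilon> = nat \<lfloor>\<epsilon> powr - \<kappa>\<rfloor>" for \<epsilon> :: real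
  \<comment> \<open>in degree zero the polynomial is its only coefficient, so no path has to be excluded\<close>
  define Osc where "Osc \<epsilon> = (if m = 0 then {} else if q0 \<le> idx \<epsilon> then B (idx \<epsilon>) else space M)" for \<epsilon> :: real
  have s0: "0 < slack m" by (simp add: slack_def)
  have Q0: "0 < Q" using s0 by (simp add: Q_def)
  have \<kappa>: "0 < \<kappa>" using Q0 by (simp add: \<kappa>_def)
  have "(2::nat) ^ 1 \<le> 2 ^ (6 * slack m)" using s0 by (intro power_increasing) auto
  then have q0: "2 \<le> q0" by (simp add: q0_def)
  have mesh: "0 < mesh_exponent m n" for n by (simp add: mesh_exponent_def)
  have "negligible_events Osc"
  proof (cases "m = 0")
    case True
    then show ?thesis by (auto simp: negligible_events_def Osc_def intro!: exI[of _ 0])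
  next
    case False
    have "negligible_events (\<lambda>\<epsilon>. if q0 \<le> nat \<lfloor>\<epsilon> powr - \<kappa>\<rfloor> then B (nat \<lfloor>\<epsilon> powr - \<kappa>\<rfloor>) else space M)"
    proof (rule negligible_events_floor_powr[OF \<kappa>])
      have ev: "irregular_event M d W q (mesh_exponent m n) \<in> events" if "q0 \<le> q" for q n
        using that q0 by (intro irregular_event_bound(1)[OF W _ mesh]) auto
      show "B q \<in> events" if "q0 \<le> q" for q
        unfolding B_def using ev[OF that] by (intro sets.finite_UN) auto
      fix p :: nat
      have "\<exists>C. \<forall>q\<ge>2. prob (irregular_event M d W q (mesh_exponent m n)) \<le> C / real q ^ p" for n
        by (rule irregular_event_superpolynomial[OF W mesh])
      then obtain C where C: "\<And>n q. 2 \<le> q \<Longrightarrow> prob (irregular_event M d W q (mesh_exponent m n)) \<le> C n / real q ^ p"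
        by metis
      have "prob (B q) \<le> (\<Sum>n\<le>m. C n) / real q ^ p" if q: "q0 \<le> q" for q
      proof -
        have "prob (B q) \<le> (\<Sum>n\<le>m. prob (irregular_event M d W q (mesh_exponent m n)))"
          unfolding B_def using ev[OF q] by (intro finite_measure_subadditive_finite) auto
        also have "\<dots> \<le> (\<Sum>n\<le>m. C n / real q ^ p)"
          using q q0 by (intro sum_mono C) auto
        finally show ?thesis by (simp add: sum_divide_distrib)
      qed
      then show "\<exists>C. \<forall>q\<ge>q0. prob (B q) \<le> C / real q ^ p" by blast
    qed (use q0 in auto)
    also have "(\<lambda>\<epsilon>. if q0 \<le> nat \<lfloor>\<epsilon> powr - \<kappa>\<rfloor> then B (nat \<lfloor>\<epsilon> powr - \<kappa>\<rfloor>) else space M) = Osc"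
      using False by (intro ext) (simp add: Osc_def idx_def)
    finally show ?thesis .
  qed
  moreover have "(SUP \<alpha>\<in>multi_indices d. sup_norm (\<lambda>t. A \<alpha> t \<omega>)) \<le> ennreal (\<epsilon> powr (1 / 3 ^ m)) \<or>
          (SUP \<alpha>\<in>multi_indices d. lip_norm (\<lambda>t. A \<alpha> t \<omega>)) \<ge> ennreal (\<epsilon> powr (- (1 / 3 ^ (m + 1))))"
    if vanish: "\<And>\<alpha> t. \<alpha> \<in> multi_indices d \<Longrightarrow> m < size \<alpha> \<Longrightarrow> t \<in> {0..1} \<Longrightarrow> A \<alpha> t \<omega> = 0"
      and \<epsilon>: "\<epsilon> \<in> {0<..1}" and \<omega>: "\<omega> \<in> space M - Osc \<epsilon>"
      and Z: "sup_norm (\<lambda>t. wiener_polynomial d W A t \<omega>) \<le> ennreal \<epsilon>"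
    for A :: "nat multiset \<Rightarrow> real \<Rightarrow> 'a \<Rightarrow> real" and \<epsilon> \<omega>
  proof (rule disjCI)
    assume "\<not> ennreal (\<epsilon> powr - (1 / 3 ^ (m + 1))) \<le> (SUP \<alpha>\<in>multi_indices d. lip_norm (\<lambda>t. A \<alpha> t \<omega>))"
    then have lip: "lip_norm (\<lambda>t. A \<alpha> t \<omega>) < ennreal (\<epsilon> powr - (1 / 3 ^ (m + 1)))" if "\<alpha> \<in> multi_indices d" for \<alpha>
      using that by (meson SUP_upper le_less_trans not_le)
    have Z': "\<bar>poly_at d m (\<lambda>\<alpha>. A \<alpha> t \<omega>) (\<lambda>k. W k t \<omega>)\<bar> \<le> \<epsilon>" if "t \<in> {0..1}" for t
    proof -
      have "\<bar>wiener_polynomial d W A t \<omega>\<bar> \<le> \<epsilon>"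
        using Z \<epsilon> that by (simp add: sup_norm_le_ennreal_iff)
      then show ?thesis
        using wiener_polynomial_eq_poly_at[of d m A t \<omega> W] vanish that by simp
    qed
    have small: "\<bar>A \<alpha> t \<omega>\<bar> \<le> \<epsilon> powr (1 / 3 ^ m)" if \<alpha>: "\<alpha> \<in> multi_indices_upto d m" and t: "t \<in> {0..1}" for \<alpha> t
    proof (cases "m = 0")
      case True
      then show ?thesis
        using Z'[OF t] \<alpha> \<epsilon> by (simp add: poly_at_def multi_indices_upto_0)
    next
      case False
      define y where "y = \<epsilon> powr - \<kappa>"
      define q where "q = idx \<epsilon>"
      have "\<omega> \<in> space M" "q0 \<le> q" "\<omega> \<notin> B q"
        using \<omega> False by (auto simp: Osc_def q_def split: if_splits)
      then have regular: "regular_path d q (mesh_exponent m n) (\<lambda>k t. W k t \<omega>)" if "n \<le> m" for n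
        using that by (auto simp: B_def irregular_event_def)
      have y_pos: "0 < y" using \<epsilon> by (simp add: y_def)
      have qy: "real q \<le> y" "y < real q + 1"
        using y_pos by (auto simp: q_def idx_def y_def)
      have y_pow: "y ^ j = \<epsilon> powr - (real j / real Q)" for j
        using \<epsilon> by (simp add: y_def \<kappa>_def powr_realpow[symmetric] powr_powr)
      have y_Q: "1 / y ^ (2 * slack m * 3 ^ (m + 1)) = \<epsilon>"
        unfolding Q_def[symmetric] y_pow using \<epsilon> Q0 by (simp add: powr_minus_divide)
      have y_2s: "y ^ (2 * slack m) = \<epsilon> powr - (1 / 3 ^ (m + 1))"
        using s0 unfolding y_pow Q_def by simp
      have y_6s: "1 / y ^ (6 * slack m) = \<epsilon> powr (1 / 3 ^ m)"
        using s0 unfolding y_pow Q_def by (simp add: powr_minus_divide)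
      show ?thesis
        unfolding y_6s[symmetric]
      proof (rule coefficients_small_on_regular_path[where w = "\<lambda>k t. W k t \<omega>" and q = q and A = "\<lambda>\<alpha> t. A \<alpha> t \<omega>", OF _ _ _ _ regular _ _ _ _ _ \<alpha> t])
        show "0 < m" using False by simp
        show "card (multi_indices_upto d m) \<le> q" "m \<le> q" "2 ^ (6 * slack m) \<le> q"
          using \<open>q0 \<le> q\<close> by (auto simp: q0_def)
        show "real q \<le> y" by (rule qy)
        show "y \<le> 2 * real q" using qy q0 \<open>q0 \<le> q\<close> by linarith
      next
        fix \<beta> s v assume \<beta>: "\<beta> \<in> multi_indices_upto d m" and v: "v \<in> {0..1::real}"
        then have *: "lip_norm (\<lambda>t. A \<beta> t \<omega>) < ennreal (y ^ (2 * slack m))"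
          unfolding y_2s by (intro lip) (simp add: multi_indices_upto_def)
        show "\<bar>A \<beta> v \<omega>\<bar> \<le> y ^ (2 * slack m)" by (rule lip_norm_less_ennrealD(1)[OF * v])
        assume s: "s \<in> {0..1::real}"
        show "\<bar>A \<beta> v \<omega> - A \<beta> s \<omega>\<bar> \<le> y ^ (2 * slack m) * \<bar>v - s\<bar>"
          by (rule lip_norm_less_ennrealD(2)[OF * s v])
      next
        fix v assume "v \<in> {0..1::real}"
        then show "\<bar>poly_at d m (\<lambda>\<alpha>. A \<alpha> v \<omega>) (\<lambda>k. W k v \<omega>)\<bar> \<le> 1 / y ^ (2 * slack m * 3 ^ (m + 1))"
          unfolding y_Q by (rule Z')
      qed
    qed
    show "(SUP \<alpha>\<in>multi_indices d. sup_norm (\<lambda>t. A \<alpha> t \<omega>)) \<le> ennreal (\<epsilon> powr (1 / 3 ^ m))"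
    proof (rule SUP_least)
      fix \<alpha> assume \<alpha>: "\<alpha> \<in> multi_indices d"
      show "sup_norm (\<lambda>t. A \<alpha> t \<omega>) \<le> ennreal (\<epsilon> powr (1 / 3 ^ m))"
        unfolding sup_norm_le_ennreal_iff[OF powr_ge_zero]
      proof
        fix t assume t: "t \<in> {0..1::real}"
        show "\<bar>A \<alpha> t \<omega>\<bar> \<le> \<epsilon> powr (1 / 3 ^ m)"
          using small[of \<alpha> t] vanish[OF \<alpha> _ t] \<alpha> t
          by (cases "size \<alpha> \<le> m") (auto simp: multi_indices_upto_def)
      qed
    qed
  qed
  ultimately show ?thesis by (intro exI[of _ Osc]) blast
qed

end
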